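(* For all $\lambda_1,\lambda_2\in[0,1]$ and all $\Phi\in\mathbb T$, the direct integral operators $\int_{\mathbb T}^\oplus W_{\lambda_1,\lambda_2,\Phi,\theta}\,d\theta$ and $\int_{\mathbb T}^\oplus W^\sharp_{\lambda_1,\lambda_2,\Phi,\theta}\,d\theta$ are unitarily equivalent as operators on $\int_{\mathbb T}^\oplus\mathscr H_1\,d\theta$.
   Context: Let $\mathbb T=\mathbb R/\mathbb Z$. Let $\mathscr H_1=\ell^2(\mathbb Z)\otimes\mathbb C^2$ with orthonormal basis $\delta_n^{s}=\delta_n\otimes e_s$ ($n\in\mathbb Z$, $s\in\{+,-\}$), $e_+=(1,0)^\top$, $e_-=(0,1)^\top$; write $\psi_n^s=\langle\delta_n^s,\psi\rangle$ and $\psi_n=(\psi_n^+,\psi_n^-)^\top$. For $\lambda\in[0,1]$ put $\lambda'=\sqrt{1-\lambda^2}$ and let $S_\lambda$ be the unitary operator with $S_\lambda\delta_n^\pm=\lambda\delta_{n\pm1}^\pm\pm\lambda'\delta_n^\mp$. For $\lambda_2\in[0,1]$, $\Phi,\theta\in\mathbb T$, $n\in\mathbb Z$ let $$Q_n=Q_{\lambda_2,\Phi,\theta,n}=\begin{bmatrix}\lambda_2\cos(2\pi(n\Phi+\theta))+i\lambda_2' & -\lambda_2\sin(2\pi(n\Phi+\theta))\\ \lambda_2\sin(2\pi(n\Phi+\theta)) & \lambda_2\cos(2\pi(n\Phi+\theta))-i\lambda_2'\end{bmatrix},$$ and let $Q_{\lambda_2,\Phi,\theta}$ act by $(Q\psi)_n=Q_n\psi_n$.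 The unitary almost-Mathieu operator is $W_{\lambda_1,\lambda_2,\Phi,\theta}=S_{\lambda_1}Q_{\lambda_2,\Phi,\theta}$ on $\mathscr H_1$, for $\lambda_1,\lambda_2\in[0,1]$. Transposes are taken with respect to the basis $\{\delta_n^s\}$, and $W^\sharp_{\lambda_1,\lambda_2,\Phi,\theta}:=W^\top_{\lambda_2,\lambda_1,\Phi,\theta}$. *)

theory Defs
  imports "HOL-Analysis.Analysis"
begin

text \<open>Basis index of H_1 = l^2(Z) (x) C^2: pairs (n, s) with s = True for the
  sign + and s = False for the sign -.  Operators are given by their matrix
  entries  A (m,s) (n,t) = <delta_m^s, A delta_n^t>.\<close>

type_synonym idx = "int \<times> bool"
type_synonym opmat = "idx \<Rightarrow> idx \<Rightarrow> complex"

definition lam' :: "real \<Rightarrow> real" where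
  "lam' l = sqrt (1 - l\<^sup>2)"

definition S_ent :: "real \<Rightarrow> opmat" where
  "S_ent l = (\<lambda>(m,s) (n,t).
     if t then (if s \<and> m = n + 1 then complex_of_real l else 0)
             + (if \<not> s \<and> m = n then complex_of_real (lam' l) else 0)
     else (if \<not> s \<and> m = n - 1 then complex_of_real l else 0)
             + (if s \<and> m = n then - complex_of_real (lam' l) else 0))"

definition Q_blk :: "real \<Rightarrow> real \<Rightarrow> real \<Rightarrow> int \<Rightarrow> bool \<Rightarrow> bool \<Rightarrow> complex" where
  "Q_blk l2 \<Phi> \<theta> n s t =
     (let a = 2 * pi * (of_int n * \<Phi> + \<theta>) in
      if s \<and> t then complex_of_real (l2 * cos a) + \<i> * complex_of_real (lam' l2)
      else if s \<and> \<not> t then - complex_of_real (l2 * sin a)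
      else if \<not> s \<and> t then complex_of_real (l2 * sin a)
      else complex_of_real (l2 * cos a) - \<i> * complex_of_real (lam' l2))"

definition Q_ent :: "real \<Rightarrow> real \<Rightarrow> real \<Rightarrow> opmat" where
  "Q_ent l2 \<Phi> \<theta> = (\<lambda>(m,s) (n,t). if m = n then Q_blk l2 \<Phi> \<theta> n s t else 0)"

text \<open>Matrix product (all products here have finitely supported rows/columns).\<close>
definition mat_mult :: "opmat \<Rightarrow> opmat \<Rightarrow> opmat" where
  "mat_mult A B = (\<lambda>x y. \<Sum>\<^sub>\<infinity>z. A x z * B z y)"

definition mat_transpose :: "opmat \<Rightarrow> opmat" where
  "mat_transpose A = (\<lambda>x y. A y x)"

definition mat_apply :: "opmat \<Rightarrow> (idx \<Rightarrow> complex) \<Rightarrow> (idx \<Rightarrow> complex)" where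
  "mat_apply A \<psi> = (\<lambda>x. \<Sum>\<^sub>\<infinity>y. A x y * \<psi> y)"

definition W_ent :: "real \<Rightarrow> real \<Rightarrow> real \<Rightarrow> real \<Rightarrow> opmat" where
  "W_ent l1 l2 \<Phi> \<theta> = mat_mult (S_ent l1) (Q_ent l2 \<Phi> \<theta>)"

definition W_sharp_ent :: "real \<Rightarrow> real \<Rightarrow> real \<Rightarrow> real \<Rightarrow> opmat" where
  "W_sharp_ent l1 l2 \<Phi> \<theta> = mat_transpose (W_ent l2 l1 \<Phi> \<theta>)"

text \<open>The direct integral Hilbert space int_T^(+) H_1 d theta = L^2(T; H_1),
  T = R/Z realised as [0,1) with Lebesgue measure; vectors are functions
  theta => H_1, taken modulo almost-everywhere equality.\<close>

abbreviation Tmeas :: "real measure" where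
  "Tmeas \<equiv> lebesgue_on {0..<1}"

definition fib_sq :: "(idx \<Rightarrow> complex) \<Rightarrow> real" where
  "fib_sq \<psi> = (\<Sum>\<^sub>\<infinity>x. (cmod (\<psi> x))\<^sup>2)"

definition DI_space :: "(real \<Rightarrow> idx \<Rightarrow> complex) set" where
  "DI_space = {f. (\<forall>x. (\<lambda>\<theta>. f \<theta> x) \<in> borel_measurable Tmeas)
      \<and> (AE \<theta> in Tmeas. (\<lambda>x. (cmod (f \<theta> x))\<^sup>2) summable_on UNIV)
      \<and> integrable Tmeas (\<lambda>\<theta>. fib_sq (f \<theta>))}"

definition di_eq :: "(real \<Rightarrow> idx \<Rightarrow> complex) \<Rightarrow> (real \<Rightarrow> idx \<Rightarrow> complex) \<Rightarrow> bool" where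
  "di_eq f g \<longleftrightarrow> (AE \<theta> in Tmeas. f \<theta> = g \<theta>)"

definition di_norm2 :: "(real \<Rightarrow> idx \<Rightarrow> complex) \<Rightarrow> real" where
  "di_norm2 f = (\<integral>\<theta>. fib_sq (f \<theta>) \<partial>Tmeas)"

definition di_unitary :: "((real \<Rightarrow> idx \<Rightarrow> complex) \<Rightarrow> (real \<Rightarrow> idx \<Rightarrow> complex)) \<Rightarrow> bool" where
  "di_unitary U \<longleftrightarrow>
     (\<forall>f\<in>DI_space. U f \<in> DI_space)
   \<and> (\<forall>f\<in>DI_space. \<forall>g\<in>DI_space. di_eq f g \<longrightarrow> di_eq (U f) (U g))
   \<and> (\<forall>f\<in>DI_space. \<forall>g\<in>DI_space. \<forall>a b::complex.
        di_eq (U (\<lambda>\<theta> x. a * f \<theta> x + b * g \<theta> x)) (\<lambda>\<theta> x. a * U f \<theta> x + b * U g \<theta> x))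
   \<and> (\<forall>f\<in>DI_space. di_norm2 (U f) = di_norm2 f)
   \<and> (\<forall>g\<in>DI_space. \<exists>f\<in>DI_space. di_eq (U f) g)"

definition dint :: "(real \<Rightarrow> opmat) \<Rightarrow> (real \<Rightarrow> idx \<Rightarrow> complex) \<Rightarrow> (real \<Rightarrow> idx \<Rightarrow> complex)" where
  "dint A f = (\<lambda>\<theta>. mat_apply (A \<theta>) (f \<theta>))"

definition di_unitarily_equivalent :: "(real \<Rightarrow> opmat) \<Rightarrow> (real \<Rightarrow> opmat) \<Rightarrow> bool" where
  "di_unitarily_equivalent A B \<longleftrightarrow>
     (\<exists>U. di_unitary U \<and> (\<forall>f\<in>DI_space. di_eq (U (dint A f)) (dint B (U f))))"

end

theory Submission
  imports Defs
begin

text \<open>The unitary is Aubry duality. In Fourier coefficients \<open>c (n, s) k\<close> of the fibre variable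
  \<open>\<theta>\<close> it is a permutation of indices with phases, combined with a rotation of the spin; it
  conjugates \<open>S\<^sub>\<lambda>\<close> into the transpose of \<open>Q\<^sub>\<lambda>\<close> and \<open>Q\<^sub>\<lambda>\<close> into the transpose of
  \<open>S\<^sub>\<lambda>\<close>, hence \<open>S Q\<close> into the transpose of a product. That these coefficients
  identify the direct integral with a sequence space is Parseval's identity and the Riesz-Fischer
  theorem, which rest on the Stone-Weierstrass theorem on the circle.\<close>

section \<open>Uniqueness of Fourier coefficients\<close>

text \<open>The duality exchanges position with the Fourier variable, so it mixes the fibres and is
  a unitary of the whole direct integral only. In Pauli matrices, \<open>S\<close> combines a
  \<open>\<sigma>\<^sub>z\<close> part in the shift with a \<open>\<sigma>\<^sub>y\<close> part of
  weight \<open>lam' l\<close>, while \<open>Q\<close> combines a \<open>\<sigma>\<^sub>y\<close>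
  part in the sine with a \<open>\<sigma>\<^sub>z\<close> part of the same weight. A quarter turn
  about \<open>\<sigma>\<^sub>x\<close> exchanges the two matrices up to one sign, and the signs
  that remain are exactly those of a transpose. Since transposing also reverses a product, the two
  couplings come out in exchanged places. The labour is analytic. Vectors are concrete functions,
  equal only almost everywhere, and divergent sums have the value 0. Hence norms are computed as
  extended nonnegative integrals, where Tonelli needs no summability, and almost-everywhere equality
  is traded for equality of coefficients, after which both intertwining relations are algebra for
  arbitrary \<Phi>.\<close>

definition trig :: "int \<Rightarrow> real \<Rightarrow> complex" where
  "trig k \<theta> = cis (2 * pi * of_int k * \<theta>)"

definition fcoef :: "(real \<Rightarrow> complex) \<Rightarrow> int \<Rightarrow> complex" where
  "fcoef f k = (\<integral>\<theta>. f \<theta> * trig (- k) \<theta> \<partial>Tmeas)"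

lemma finite_measure_Tmeas: "finite_measure Tmeas"
  by (rule finite_measureI) (simp add: emeasure_restrict_space)

interpretation Tm: finite_measure Tmeas
  by (rule finite_measure_Tmeas)

lemma borel_measurable_Tmeas:
  "f \<in> borel_measurable borel \<Longrightarrow> f \<in> borel_measurable Tmeas"
  by (rule measurable_restrict_space1, rule measurable_completion) simp

lemma trig_measurable [measurable]: "trig k \<in> borel_measurable Tmeas"
proof (rule borel_measurable_Tmeas)
  have "continuous_on UNIV (trig k)"
    unfolding trig_def by (intro continuous_intros)
  then show "trig k \<in> borel_measurable borel"
    by (rule borel_measurable_continuous_onI)
qed

lemma norm_trig [simp]: "cmod (trig k \<theta>) = 1"
  by (simp add: trig_def)

lemma trig_mult: "trig j \<theta> * trig k \<theta> = trig (j + k) \<theta>"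
  by (simp add: trig_def cis_mult algebra_simps)

lemma trig_0 [simp]: "trig 0 \<theta> = 1"
  by (simp add: trig_def)

lemma cnj_trig: "cnj (trig k \<theta>) = trig (- k) \<theta>"
  by (simp add: trig_def cis_cnj)

lemma integrable_mult_bounded:
  fixes f g :: "'a \<Rightarrow> complex"
  assumes f: "integrable M f" and [measurable]: "g \<in> borel_measurable M"
    and b: "\<And>x. x \<in> space M \<Longrightarrow> cmod (g x) \<le> B"
  shows "integrable M (\<lambda>x. f x * g x)"
proof (rule Bochner_Integration.integrable_bound)
  show "integrable M (\<lambda>x. complex_of_real B * f x)" using f by simp
  show "(\<lambda>x. f x * g x) \<in> borel_measurable M" using f by measurable
  have "cmod (f x) * cmod (g x) \<le> \<bar>B\<bar> * cmod (f x)" if "x \<in> space M" for x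
    using mult_left_mono[OF b[OF that], of "cmod (f x)"]
      mult_right_mono[OF abs_ge_self[of B], of "cmod (f x)"] by (simp add: mult.commute)
  then show "AE x in M. cmod (f x * g x) \<le> cmod (complex_of_real B * f x)"
    by (intro AE_I2) (simp add: norm_mult)
qed

lemma integrable_mult_trig:
  "integrable Tmeas f \<Longrightarrow> integrable Tmeas (\<lambda>\<theta>. f \<theta> * trig k \<theta>)"
  by (rule integrable_mult_bounded[where B = 1]) auto

lemma fcoef_mult_trig: "fcoef (\<lambda>\<theta>. f \<theta> * trig j \<theta>) k = fcoef f (k - j)"
  by (simp add: fcoef_def mult.assoc trig_mult)

lemma fcoef_add:
  assumes "integrable Tmeas f" "integrable Tmeas g"
  shows "fcoef (\<lambda>\<theta>. f \<theta> + g \<theta>) k = fcoef f k + fcoef g k"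
  using assms by (simp add: fcoef_def distrib_right integrable_mult_trig)

lemma fcoef_diff:
  assumes "integrable Tmeas f" "integrable Tmeas g"
  shows "fcoef (\<lambda>\<theta>. f \<theta> - g \<theta>) k = fcoef f k - fcoef g k"
  using assms by (simp add: fcoef_def left_diff_distrib integrable_mult_trig)

lemma fcoef_cmult: "fcoef (\<lambda>\<theta>. a * f \<theta>) k = a * fcoef f k"
  by (simp add: fcoef_def mult.assoc)

lemma integral_trig: "(\<integral>\<theta>. trig k \<theta> \<partial>Tmeas) = (if k = 0 then 1 else 0)"
proof (cases "k = 0")
  case True
  then show ?thesis
    by (simp add: measure_restrict_space)
next
  case False
  define F where "F = (\<lambda>\<theta>. trig k \<theta> / (2 * pi * of_int k * \<i>))"
  have F: "F = (\<lambda>\<theta>. exp (2 * pi * of_int k * \<i> * of_real \<theta>) / (2 * pi * of_int k * \<i>))"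
    by (simp add: F_def trig_def cis_conv_exp mult_ac)
  have "((\<lambda>z. exp (2 * pi * of_int k * \<i> * z) / (2 * pi * of_int k * \<i>)) has_field_derivative
      exp (2 * pi * of_int k * \<i> * z)) (at z)" for z
    using False by (auto intro!: derivative_eq_intros)
  then have "(F has_vector_derivative trig k \<theta>) (at \<theta> within {0..1})" for \<theta>
    unfolding F trig_def cis_conv_exp
    by (rule has_vector_derivative_real_field[THEN has_vector_derivative_at_within, THEN has_vector_derivative_eq_rhs])
       (simp add: mult_ac)
  then have "(trig k has_integral (F 1 - F 0)) {0..1}"
    by (intro fundamental_theorem_of_calculus) auto
  moreover have "F 1 = F 0"
    using cis_multiple_2pi[of "of_int k"] by (simp add: F_def trig_def mult.commute)
  ultimately have *: "(trig k has_integral 0) {0..1}" by simp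
  have "(\<integral>\<theta>. trig k \<theta> \<partial>Tmeas) = integral {0..<1} (trig k)"
  proof (rule lebesgue_integral_eq_integral)
    show "integrable Tmeas (trig k)"
      using integrable_mult_trig[of "\<lambda>_. 1" k] by simp
  qed auto
  \<comment> \<open>The fundamental theorem lives on the closed interval, \<open>Tmeas\<close> on
    the half-open one; they differ by the point 1.\<close>
  also have "\<dots> = integral {0..1} (trig k)"
  proof (rule integral_spike_set)
    have "{x \<in> {0..<1} - {0..1}. trig k x \<noteq> 0} = {}" by auto
    then show "negligible {x \<in> {0..<1} - {0..1}. trig k x \<noteq> 0}" by (simp only: negligible_empty)
    have "{x \<in> {0..1} - {0..<1}. trig k x \<noteq> 0} \<subseteq> {1::real}" by auto
    then show "negligible {x \<in> {0..1} - {0..<1}. trig k x \<noteq> 0}"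
      using negligible_subset negligible_sing by blast
  qed
  finally show ?thesis using * False by (simp add: integral_unique)
qed

text \<open>Quantifying over all \<open>f\<close> with vanishing coefficients makes the property multiplicative
  in \<open>p\<close>, so trigonometric polynomials need not be expanded.\<close>

lemma fcoef_zero_mult_poly:
  assumes "real_polynomial_function (p :: complex \<Rightarrow> real)"
  shows "integrable Tmeas f \<Longrightarrow> (\<And>k. fcoef f k = 0) \<Longrightarrow>
    integrable Tmeas (\<lambda>\<theta>. f \<theta> * of_real (p (trig 1 \<theta>))) \<and>
    (\<forall>k. fcoef (\<lambda>\<theta>. f \<theta> * of_real (p (trig 1 \<theta>))) k = 0)"
  using assms
proof (induction p arbitrary: f rule: real_polynomial_function.induct)
  case (linear h)
  then interpret h: bounded_linear h by simp
  \<comment> \<open>A real-linear \<open>h\<close> on the plane has the form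
    \<open>h z = u * z + cnj u * cnj z\<close>, and on the circle \<open>cnj z\<close> is
    \<open>trig (-1)\<close>. Multiplication by \<open>h\<close> therefore only combines the
    coefficients at \<open>k - 1\<close> and \<open>k + 1\<close>.\<close>
  define u where "u = Complex (h 1) (- h \<i>) / 2"
  have h: "complex_of_real (h (trig 1 \<theta>)) = u * trig 1 \<theta> + cnj u * trig (-1) \<theta>" for \<theta>
  proof -
    have "trig 1 \<theta> = Re (trig 1 \<theta>) *\<^sub>R 1 + Im (trig 1 \<theta>) *\<^sub>R \<i>"
      by (simp add: complex_eq_iff)
    then have "h (trig 1 \<theta>) = Re (trig 1 \<theta>) * h 1 + Im (trig 1 \<theta>) * h \<i>"
      by (metis h.add h.scaleR real_scaleR_def)
    then show ?thesis
      by (simp add: cnj_trig[symmetric] complex_eq_iff u_def field_simps)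
  qed
  have e: "f \<theta> * complex_of_real (h (trig 1 \<theta>)) = u * (f \<theta> * trig 1 \<theta>) + cnj u * (f \<theta> * trig (-1) \<theta>)" for \<theta>
    unfolding h by (simp add: algebra_simps)
  show ?case
    unfolding e using linear
    by (simp add: integrable_mult_trig fcoef_add fcoef_cmult fcoef_mult_trig)
next
  case (const c)
  then show ?case
    using fcoef_cmult[of "of_real c" f] by (simp add: mult.commute)
next
  case (add p q)
  then show ?case
    by (simp add: distrib_left fcoef_add)
next
  case (mult p q)
  have e: "f \<theta> * complex_of_real (p (trig 1 \<theta>) * q (trig 1 \<theta>)) =
     (f \<theta> * of_real (p (trig 1 \<theta>))) * of_real (q (trig 1 \<theta>))" for \<theta> by simp
  show ?case
    unfolding e using mult by blast
qed

text \<open>A polynomial that is uniformly within \<open>e\<close> of \<phi> on the unit circle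
  integrates to 0 against \<open>f\<close>, so the integral is at most \<open>e\<close> times the L1
  norm of \<open>f\<close>. Working on the circle in the plane builds periodicity into the test
  functions.\<close>

lemma integral_zero_mult_continuous:
  fixes \<phi> :: "complex \<Rightarrow> real"
  assumes f: "integrable Tmeas f" and z: "\<And>k. fcoef f k = 0"
    and c: "continuous_on UNIV \<phi>"
  shows "(\<integral>\<theta>. f \<theta> * of_real (\<phi> (trig 1 \<theta>)) \<partial>Tmeas) = 0"
proof -
  define J where "J = (\<integral>\<theta>. f \<theta> * of_real (\<phi> (trig 1 \<theta>)) \<partial>Tmeas)"
  define N where "N = (\<integral>\<theta>. cmod (f \<theta>) \<partial>Tmeas)"
  have cp: "continuous_on UNIV (trig 1)"
    unfolding trig_def by (intro continuous_intros)
  have S: "compact (sphere (0::complex) 1)" by simp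
  have "bounded (\<phi> ` sphere 0 1)"
    using c S by (intro compact_imp_bounded compact_continuous_image) (auto intro: continuous_on_subset)
  then obtain B where B: "\<forall>w\<in>sphere 0 1. \<bar>\<phi> w\<bar> \<le> B"
    by (auto simp: bounded_iff)
  have m: "(\<lambda>\<theta>. complex_of_real (\<phi> (trig 1 \<theta>))) \<in> borel_measurable Tmeas"
    by (intro borel_measurable_Tmeas borel_measurable_continuous_onI continuous_on_of_real
        continuous_on_compose2[OF c cp]) auto
  have i: "integrable Tmeas (\<lambda>\<theta>. f \<theta> * of_real (\<phi> (trig 1 \<theta>)))"
  proof (rule integrable_mult_bounded[OF f m])
    fix \<theta>
    show "cmod (of_real (\<phi> (trig 1 \<theta>))) \<le> B"
      using B by (simp only: norm_of_real) simp
  qed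
  have "cmod J \<le> e * N" if e: "e > 0" for e
  proof -
    obtain p where p: "real_polynomial_function p"
      and pe: "\<And>w. w \<in> sphere 0 1 \<Longrightarrow> \<bar>\<phi> w - p w\<bar> < e"
      using Stone_Weierstrass_real_polynomial_function[OF S continuous_on_subset[OF c subset_UNIV] e]
      by blast
    have pz: "integrable Tmeas (\<lambda>\<theta>. f \<theta> * of_real (p (trig 1 \<theta>)))"
      "fcoef (\<lambda>\<theta>. f \<theta> * of_real (p (trig 1 \<theta>))) 0 = 0"
      using fcoef_zero_mult_poly[OF p f z] by auto
    have "J = (\<integral>\<theta>. f \<theta> * of_real (\<phi> (trig 1 \<theta>)) - f \<theta> * of_real (p (trig 1 \<theta>)) \<partial>Tmeas)"
      using pz i by (simp add: J_def fcoef_def)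
    also have "cmod \<dots> \<le> (\<integral>\<theta>. e * cmod (f \<theta>) \<partial>Tmeas)"
    proof (rule Bochner_Integration.integral_norm_bound_integral)
      show "integrable Tmeas (\<lambda>\<theta>. f \<theta> * of_real (\<phi> (trig 1 \<theta>)) - f \<theta> * of_real (p (trig 1 \<theta>)))"
        using pz i by simp
      show "integrable Tmeas (\<lambda>\<theta>. e * cmod (f \<theta>))" using f by simp
      fix \<theta>
      have "f \<theta> * of_real (\<phi> (trig 1 \<theta>)) - f \<theta> * of_real (p (trig 1 \<theta>)) =
        of_real (\<phi> (trig 1 \<theta>) - p (trig 1 \<theta>)) * f \<theta>"
        by (simp add: algebra_simps)
      moreover have "\<bar>\<phi> (trig 1 \<theta>) - p (trig 1 \<theta>)\<bar> \<le> e"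
        using pe[of "trig 1 \<theta>"] by simp
      ultimately show "cmod (f \<theta> * of_real (\<phi> (trig 1 \<theta>)) - f \<theta> * of_real (p (trig 1 \<theta>))) \<le> e * cmod (f \<theta>)"
        by (simp only: norm_mult norm_of_real) (rule mult_right_mono, auto)
    qed
    finally show ?thesis by (simp add: N_def)
  qed
  moreover have "N \<ge> 0" by (simp add: N_def)
  ultimately have "cmod J \<le> 0"
  proof -
    assume a: "\<And>e. 0 < e \<Longrightarrow> cmod J \<le> e * N" and "N \<ge> 0"
    show ?thesis
    proof (rule field_le_epsilon)
      fix d :: real assume "d > 0"
      \<comment> \<open>The divisor is \<open>N + 1\<close> because \<open>N\<close> may be
        0.\<close>
      then have "cmod J \<le> d / (N + 1) * N" using a[of "d / (N + 1)"] \<open>N \<ge> 0\<close> by simp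
      also have "\<dots> \<le> d" using \<open>d > 0\<close> \<open>N \<ge> 0\<close> by (simp add: field_simps)
      finally show "cmod J \<le> 0 + d" by simp
    qed
  qed
  then show ?thesis by (simp add: J_def)
qed

section \<open>From continuous test functions to compact sets\<close>

lemma inj_on_trig_1: "inj_on (trig 1) {0..<1}"
proof (rule inj_onI)
  fix x y :: real assume xy: "x \<in> {0..<1}" "y \<in> {0..<1}" "trig 1 x = trig 1 y"
  then obtain n :: int where "2 * pi * x = 2 * pi * y + 2 * pi * of_int n"
    using sin_cos_eq_iff[of "2 * pi * x" "2 * pi * y"]
    by (auto simp: trig_def complex_eq_iff)
  then have "2 * pi * (x - y) = 2 * pi * of_int n" by (simp add: algebra_simps)
  then have "x - y = of_int n" by simp
  \<comment> \<open>The bound is strict because the interval is half-open; 0 and 1 have the same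
    image on the circle.\<close>
  moreover have "\<bar>x - y\<bar> < 1" using xy by auto
  ultimately have "n = 0" by linarith
  then show "x = y" using \<open>x - y = of_int n\<close> by simp
qed

text \<open>The indicator of a compact set is a bounded pointwise limit of continuous functions of
  the distance. The distance is measured on the circle, to the image of \<open>K\<close>, and
  injectivity of \<open>trig 1\<close> recovers \<open>K\<close> from that image.\<close>

lemma integral_zero_compact:
  assumes f: "integrable Tmeas f" and z: "\<And>k. fcoef f k = 0"
    and K: "compact K" "K \<subseteq> {0..<1}"
  shows "(\<integral>\<theta>. f \<theta> * indicator K \<theta> \<partial>Tmeas) = 0"
proof (cases "K = {}")
  case False
  define L where "L = trig 1 ` K"
  have cp: "continuous_on UNIV (trig 1)"
    unfolding trig_def by (intro continuous_intros)
  have L: "closed L" "L \<noteq> {}"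
    using K False unfolding L_def
    by (auto intro!: compact_imp_closed compact_continuous_image continuous_on_subset[OF cp])
  \<comment> \<open>Tents of slope \<open>n\<close> around \<open>L\<close>. The empty set had to be
    split off, since \<open>infdist\<close> to it is 0 by convention and each tent would be
    constantly 1.\<close>
  define \<phi> where "\<phi> n w = max 0 (1 - real n * infdist w L)" for n w
  have c\<phi>: "continuous_on UNIV (\<phi> n)" for n
    unfolding \<phi>_def by (intro continuous_intros)
  have b: "0 \<le> \<phi> n w" "\<phi> n w \<le> 1" for n w
    by (auto simp: \<phi>_def infdist_nonneg)
  have lim: "(\<lambda>n. \<phi> n (trig 1 \<theta>)) \<longlonglongrightarrow> indicator K \<theta>" if \<theta>: "\<theta> \<in> {0..<1}" for \<theta>
  proof (cases "\<theta> \<in> K")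
    case True
    then have "trig 1 \<theta> \<in> L" by (simp add: L_def)
    then show ?thesis using True by (simp add: \<phi>_def)
  next
    case F: False
    then have "trig 1 \<theta> \<notin> L"
      using inj_onD[OF inj_on_trig_1] \<theta> K unfolding L_def by blast
    then have d: "infdist (trig 1 \<theta>) L > 0"
      using L by (simp add: infdist_pos_not_in_closed)
    obtain n0 where n0: "1 < real n0 * infdist (trig 1 \<theta>) L"
      using reals_Archimedean3[OF d] by blast
    have "\<forall>\<^sub>F n in sequentially. \<phi> n (trig 1 \<theta>) = 0"
      using eventually_ge_at_top[of n0]
    proof eventually_elim
      case (elim n)
      then have "real n0 * infdist (trig 1 \<theta>) L \<le> real n * infdist (trig 1 \<theta>) L"
        using d by (intro mult_right_mono) auto
      then show ?case using n0 by (simp add: \<phi>_def)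
    qed
    then show ?thesis using F by (simp add: tendsto_eventually)
  qed
  have "(\<lambda>n. \<integral>\<theta>. f \<theta> * of_real (\<phi> n (trig 1 \<theta>)) \<partial>Tmeas) \<longlonglongrightarrow> (\<integral>\<theta>. f \<theta> * indicator K \<theta> \<partial>Tmeas)"
  proof (rule integral_dominated_convergence[where w = "\<lambda>\<theta>. cmod (f \<theta>)"])
    have [measurable]: "K \<in> sets Tmeas"
      using K by (auto simp: sets_restrict_space_iff intro: lmeasurable_compact fmeasurableD)
    show "(\<lambda>\<theta>. f \<theta> * indicator K \<theta>) \<in> borel_measurable Tmeas"
      using f by measurable
    have [measurable]: "(\<lambda>\<theta>. complex_of_real (\<phi> n (trig 1 \<theta>))) \<in> borel_measurable Tmeas" for n
      by (intro borel_measurable_Tmeas borel_measurable_continuous_onI continuous_on_of_real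
          continuous_on_compose2[OF c\<phi> cp]) auto
    show "(\<lambda>\<theta>. f \<theta> * of_real (\<phi> n (trig 1 \<theta>))) \<in> borel_measurable Tmeas" for n
      using f by measurable
    show "integrable Tmeas (\<lambda>\<theta>. cmod (f \<theta>))" using f by simp
    show "AE \<theta> in Tmeas. (\<lambda>n. f \<theta> * of_real (\<phi> n (trig 1 \<theta>))) \<longlonglongrightarrow> f \<theta> * indicator K \<theta>"
    proof (rule AE_I2)
      fix \<theta> assume "\<theta> \<in> space Tmeas"
      then have "\<theta> \<in> {0..<1}" by simp
      from tendsto_of_real[OF lim[OF this], where ?'a = complex]
      have "(\<lambda>n. complex_of_real (\<phi> n (trig 1 \<theta>))) \<longlonglongrightarrow> indicator K \<theta>"
        by (simp add: indicator_def of_bool_def split: if_splits)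
      then show "(\<lambda>n. f \<theta> * of_real (\<phi> n (trig 1 \<theta>))) \<longlonglongrightarrow> f \<theta> * indicator K \<theta>"
        by (intro tendsto_intros)
    qed
    show "AE \<theta> in Tmeas. cmod (f \<theta> * of_real (\<phi> n (trig 1 \<theta>))) \<le> cmod (f \<theta>)" for n
      using b by (intro AE_I2) (simp add: norm_mult mult_left_le)
  qed
  moreover have "(\<integral>\<theta>. f \<theta> * of_real (\<phi> n (trig 1 \<theta>)) \<partial>Tmeas) = 0" for n
    by (rule integral_zero_mult_continuous[OF f z c\<phi>])
  ultimately show ?thesis
    by (simp add: LIMSEQ_const_iff)
qed simp

text \<open>Inner regularity: up to a null set, the set where \<open>g\<close> is positive is a
  countable union of compact sets. On each of them \<open>g\<close> is positive and has integral 0,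
  so each is null.\<close>

lemma AE_nonpos_of_integral_compact:
  fixes g :: "real \<Rightarrow> real"
  assumes g: "integrable Tmeas g"
    and z: "\<And>K. compact K \<Longrightarrow> K \<subseteq> {0..<1} \<Longrightarrow> (\<integral>\<theta>. g \<theta> * indicator K \<theta> \<partial>Tmeas) = 0"
  shows "AE \<theta> in Tmeas. g \<theta> \<le> 0"
proof -
  define A where "A = {\<theta> \<in> {0..<1}. g \<theta> > 0}"
  have gm [measurable]: "g \<in> borel_measurable Tmeas" using g by simp
  have "{\<theta> \<in> space Tmeas. g \<theta> > 0} \<in> sets Tmeas" by measurable
  then have "A \<in> sets lebesgue"
    by (auto simp: A_def sets_restrict_space_iff)
  then obtain C T where C: "fsigma C" and T: "T \<in> null_sets lebesgue" and CT: "C \<union> T = A"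
    by (rule lebesgue_set_almost_fsigma)
  obtain F :: "nat \<Rightarrow> real set" where F: "range F \<subseteq> Collect compact" and CF: "C = \<Union>(range F)"
    using fsigma_Union_compact C by metis
  have "AE \<theta> in Tmeas. \<theta> \<notin> F n" for n
  proof -
    have K: "compact (F n)" "F n \<subseteq> A" using F CF CT by auto
    then have K': "F n \<subseteq> {0..<1}" by (auto simp: A_def)
    have [measurable]: "F n \<in> sets Tmeas"
      using K K' by (auto simp: sets_restrict_space_iff intro: lmeasurable_compact fmeasurableD)
    have "AE \<theta> in Tmeas. g \<theta> * indicator (F n) \<theta> = 0"
    proof (subst integral_nonneg_eq_0_iff_AE[symmetric])
      show "integrable Tmeas (\<lambda>\<theta>. g \<theta> * indicator (F n) \<theta>)"
        using g by (rule integrable_real_mult_indicator[rotated]) measurable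
      show "AE \<theta> in Tmeas. 0 \<le> g \<theta> * indicator (F n) \<theta>"
        using K by (intro AE_I2) (auto simp: A_def indicator_def)
      show "(\<integral>\<theta>. g \<theta> * indicator (F n) \<theta> \<partial>Tmeas) = 0" by (rule z[OF K(1) K'])
    qed
    then show ?thesis
      by eventually_elim (use K in \<open>auto simp: A_def indicator_def split: if_splits\<close>)
  qed
  then have "AE \<theta> in Tmeas. \<forall>n. \<theta> \<notin> F n" by (simp add: AE_all_countable)
  moreover have "AE \<theta> in Tmeas. \<theta> \<notin> T"
    using AE_not_in[OF T] by (auto simp: AE_restrict_space_iff elim!: eventually_mono)
  moreover have "AE \<theta> in Tmeas. \<theta> \<in> {0..<1}" by (intro AE_I2) simp
  ultimately show ?thesis
  proof eventually_elim
    case (elim \<theta>)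
    then have "\<theta> \<notin> A" using CT CF by auto
    then show ?case using elim by (auto simp: A_def)
  qed
qed

lemma AE_zero_of_integral_compact:
  fixes g :: "real \<Rightarrow> real"
  assumes g: "integrable Tmeas g"
    and z: "\<And>K. compact K \<Longrightarrow> K \<subseteq> {0..<1} \<Longrightarrow> (\<integral>\<theta>. g \<theta> * indicator K \<theta> \<partial>Tmeas) = 0"
  shows "AE \<theta> in Tmeas. g \<theta> = 0"
proof -
  have "AE \<theta> in Tmeas. g \<theta> \<le> 0"
    by (rule AE_nonpos_of_integral_compact[OF g z])
  moreover have "AE \<theta> in Tmeas. - g \<theta> \<le> 0"
    by (rule AE_nonpos_of_integral_compact) (use g z in auto)
  ultimately show ?thesis by eventually_elim simp
qed

lemma fcoef_unique:
  assumes f: "integrable Tmeas f" and z: "\<And>k. fcoef f k = 0"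
  shows "AE \<theta> in Tmeas. f \<theta> = 0"
proof -
  have iK: "integrable Tmeas (\<lambda>\<theta>. f \<theta> * indicator K \<theta>)" if K: "compact K" "K \<subseteq> {0..<1}" for K
  proof (rule integrable_mult_bounded[OF f, where B = 1])
    have [measurable]: "K \<in> sets Tmeas"
      using K by (auto simp: sets_restrict_space_iff intro: lmeasurable_compact fmeasurableD)
    show "indicator K \<in> borel_measurable Tmeas" by measurable
  qed (auto simp: indicator_def)
  have "AE \<theta> in Tmeas. Re (f \<theta>) = 0"
  proof (rule AE_zero_of_integral_compact)
    fix K :: "real set" assume K: "compact K" "K \<subseteq> {0..<1}"
    have "(\<integral>\<theta>. Re (f \<theta>) * indicator K \<theta> \<partial>Tmeas) = (\<integral>\<theta>. Re (f \<theta> * indicator K \<theta>) \<partial>Tmeas)"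
      by (rule Bochner_Integration.integral_cong) (auto simp: indicator_def)
    also have "\<dots> = 0"
      by (simp only: integral_Re[OF iK[OF K]] integral_zero_compact[OF f z K] zero_complex.sel)
    finally show "(\<integral>\<theta>. Re (f \<theta>) * indicator K \<theta> \<partial>Tmeas) = 0" .
  qed (use f in simp)
  moreover have "AE \<theta> in Tmeas. Im (f \<theta>) = 0"
  proof (rule AE_zero_of_integral_compact)
    fix K :: "real set" assume K: "compact K" "K \<subseteq> {0..<1}"
    have "(\<integral>\<theta>. Im (f \<theta>) * indicator K \<theta> \<partial>Tmeas) = (\<integral>\<theta>. Im (f \<theta> * indicator K \<theta>) \<partial>Tmeas)"
      by (rule Bochner_Integration.integral_cong) (auto simp: indicator_def)
    also have "\<dots> = 0"
      by (simp only: integral_Im[OF iK[OF K]] integral_zero_compact[OF f z K] zero_complex.sel)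
    finally show "(\<integral>\<theta>. Im (f \<theta>) * indicator K \<theta> \<partial>Tmeas) = 0" .
  qed (use f in simp)
  ultimately show ?thesis
    by eventually_elim (simp add: complex_eq_iff)
qed

section \<open>Parseval's identity and the Riesz-Fischer theorem\<close>

definition sqint :: "(real \<Rightarrow> complex) \<Rightarrow> bool" where
  "sqint f \<longleftrightarrow> f \<in> borel_measurable Tmeas \<and> integrable Tmeas (\<lambda>\<theta>. (cmod (f \<theta>))\<^sup>2)"

definition trig_sum :: "int set \<Rightarrow> (int \<Rightarrow> complex) \<Rightarrow> real \<Rightarrow> complex" where
  "trig_sum F d \<theta> = (\<Sum>k\<in>F. d k * trig k \<theta>)"

lemma sqint_integrable:
  assumes "sqint f" shows "integrable Tmeas f"
proof (rule Bochner_Integration.integrable_bound)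
  show "integrable Tmeas (\<lambda>\<theta>. 1 + (cmod (f \<theta>))\<^sup>2)"
    using assms by (simp add: sqint_def)
  have "x \<le> 1 + x\<^sup>2" for x :: real
  proof -
    have "2 * x \<le> x\<^sup>2 + 1"
      using zero_le_power2[of "x - 1"] by (simp add: power2_diff)
    with zero_le_power2[of x] show ?thesis by linarith
  qed
  then show "AE \<theta> in Tmeas. cmod (f \<theta>) \<le> norm (1 + (cmod (f \<theta>))\<^sup>2)"
    by (intro AE_I2) auto
qed (use assms in \<open>simp add: sqint_def\<close>)

lemma sqint_bound:
  assumes f: "integrable Tmeas (w :: real \<Rightarrow> real)" and g: "g \<in> borel_measurable Tmeas"
    and "\<And>\<theta>. (cmod (g \<theta>))\<^sup>2 \<le> w \<theta>"
  shows "sqint g"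
  unfolding sqint_def
proof (intro conjI g, rule Bochner_Integration.integrable_bound[OF f])
  show "(\<lambda>\<theta>. (cmod (g \<theta>))\<^sup>2) \<in> borel_measurable Tmeas" using g by measurable
  show "AE \<theta> in Tmeas. norm ((cmod (g \<theta>))\<^sup>2) \<le> norm (w \<theta>)"
    using assms(3) by (intro AE_I2) (auto intro: order_trans[OF _ abs_ge_self])
qed

lemma norm_add_square_le: "(cmod (a + b))\<^sup>2 \<le> 2 * (cmod a)\<^sup>2 + 2 * (cmod b)\<^sup>2"
proof -
  have "(cmod (a + b))\<^sup>2 \<le> (cmod a + cmod b)\<^sup>2"
    by (intro power_mono norm_triangle_ineq) auto
  also have "\<dots> \<le> 2 * (cmod a)\<^sup>2 + 2 * (cmod b)\<^sup>2"
    using zero_le_power2[of "cmod a - cmod b"] by (simp add: power2_diff power2_sum)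
  finally show ?thesis .
qed

lemma sqint_add:
  assumes "sqint f" "sqint g" shows "sqint (\<lambda>\<theta>. f \<theta> + g \<theta>)"
  by (rule sqint_bound[where w = "\<lambda>\<theta>. 2 * (cmod (f \<theta>))\<^sup>2 + 2 * (cmod (g \<theta>))\<^sup>2"])
     (use assms norm_add_square_le in \<open>auto simp: sqint_def\<close>)

lemma sqint_cmult:
  assumes "sqint f" shows "sqint (\<lambda>\<theta>. a * f \<theta>)"
  using assms by (auto simp: sqint_def norm_mult power_mult_distrib)

lemma sqint_diff:
  assumes "sqint f" "sqint g" shows "sqint (\<lambda>\<theta>. f \<theta> - g \<theta>)"
  using sqint_add[OF assms(1) sqint_cmult[OF assms(2), of "-1"]] by simp

lemma sqint_trig_sum: "sqint (trig_sum F d)"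
proof (rule sqint_bound)
  show "integrable Tmeas (\<lambda>_. (\<Sum>k\<in>F. cmod (d k))\<^sup>2)" by simp
  show "trig_sum F d \<in> borel_measurable Tmeas"
    unfolding trig_sum_def[abs_def] by measurable
  fix \<theta>
  have "cmod (trig_sum F d \<theta>) \<le> (\<Sum>k\<in>F. cmod (d k))"
    unfolding trig_sum_def by (rule order_trans[OF norm_sum]) (simp add: norm_mult)
  then show "(cmod (trig_sum F d \<theta>))\<^sup>2 \<le> (\<Sum>k\<in>F. cmod (d k))\<^sup>2"
    by (intro power_mono) auto
qed

section \<open>Orthogonality and Bessel's inequality\<close>

lemma fcoef_trig_sum:
  assumes "finite F"
  shows "fcoef (trig_sum F d) k = (if k \<in> F then d k else 0)"
proof -
  have i: "integrable Tmeas (trig j)" for j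
    using integrable_mult_trig[of "\<lambda>_. 1" j] by simp
  have "fcoef (trig_sum F d) k = (\<integral>\<theta>. (\<Sum>j\<in>F. d j * trig (j - k) \<theta>) \<partial>Tmeas)"
    unfolding fcoef_def trig_sum_def by (simp add: sum_distrib_right mult.assoc trig_mult)
  also have "\<dots> = (\<Sum>j\<in>F. d j * (if j = k then 1 else 0))"
    using i by (simp add: integral_trig)
  also have "\<dots> = (if k \<in> F then d k else 0)"
    using assms by (simp add: if_distrib cong: if_cong)
  finally show ?thesis .
qed

lemma
  assumes "integrable Tmeas f"
  shows integrable_mult_cnj_trig_sum: "integrable Tmeas (\<lambda>\<theta>. f \<theta> * cnj (trig_sum F d \<theta>))"
    and integral_mult_cnj_trig_sum:
      "(\<integral>\<theta>. f \<theta> * cnj (trig_sum F d \<theta>) \<partial>Tmeas) = (\<Sum>k\<in>F. cnj (d k) * fcoef f k)"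
proof -
  have e: "f \<theta> * cnj (trig_sum F d \<theta>) = (\<Sum>k\<in>F. cnj (d k) * (f \<theta> * trig (- k) \<theta>))" for \<theta>
    by (simp add: trig_sum_def sum_distrib_left cnj_trig mult_ac)
  show "integrable Tmeas (\<lambda>\<theta>. f \<theta> * cnj (trig_sum F d \<theta>))"
    "(\<integral>\<theta>. f \<theta> * cnj (trig_sum F d \<theta>) \<partial>Tmeas) = (\<Sum>k\<in>F. cnj (d k) * fcoef f k)"
    unfolding e using assms by (simp_all add: fcoef_def integrable_mult_trig)
qed

lemma norm_trig_sum:
  assumes "finite F"
  shows "(\<integral>\<theta>. (cmod (trig_sum F d \<theta>))\<^sup>2 \<partial>Tmeas) = (\<Sum>k\<in>F. (cmod (d k))\<^sup>2)"
proof -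
  have "complex_of_real (\<integral>\<theta>. (cmod (trig_sum F d \<theta>))\<^sup>2 \<partial>Tmeas)
      = (\<integral>\<theta>. trig_sum F d \<theta> * cnj (trig_sum F d \<theta>) \<partial>Tmeas)"
    by (simp flip: integral_complex_of_real complex_norm_square)
  also have "\<dots> = (\<Sum>k\<in>F. cnj (d k) * d k)"
    using assms
    by (subst integral_mult_cnj_trig_sum[OF sqint_integrable[OF sqint_trig_sum]])
       (simp add: fcoef_trig_sum)
  also have "\<dots> = complex_of_real (\<Sum>k\<in>F. (cmod (d k))\<^sup>2)"
    by (simp add: complex_norm_square mult.commute del: of_real_power)
  finally show ?thesis by (simp only: of_real_eq_iff)
qed

text \<open>Pythagoras with an exact remainder: the cross term and the square of the partial sum
  both equal the sum of the squared coefficients. The remainder gives Bessel's inequality, and later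
  the norm of the Riesz-Fischer limit.\<close>

lemma norm_diff_fourier_sum:
  assumes f: "sqint f" and F: "finite F"
  shows "(\<integral>\<theta>. (cmod (f \<theta> - trig_sum F (fcoef f) \<theta>))\<^sup>2 \<partial>Tmeas) =
    (\<integral>\<theta>. (cmod (f \<theta>))\<^sup>2 \<partial>Tmeas) - (\<Sum>k\<in>F. (cmod (fcoef f k))\<^sup>2)"
proof -
  let ?p = "trig_sum F (fcoef f)"
  have i: "integrable Tmeas (\<lambda>\<theta>. f \<theta> * cnj (?p \<theta>))"
    by (rule integrable_mult_cnj_trig_sum[OF sqint_integrable[OF f]])
  have "(\<integral>\<theta>. f \<theta> * cnj (?p \<theta>) \<partial>Tmeas) = complex_of_real (\<Sum>k\<in>F. (cmod (fcoef f k))\<^sup>2)"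
    by (simp add: integral_mult_cnj_trig_sum[OF sqint_integrable[OF f]] complex_norm_square
        mult.commute del: of_real_power)
  then have R: "(\<integral>\<theta>. Re (f \<theta> * cnj (?p \<theta>)) \<partial>Tmeas) = (\<Sum>k\<in>F. (cmod (fcoef f k))\<^sup>2)"
    by (simp only: integral_Re[OF i] Re_complex_of_real)
  have e: "(cmod (f \<theta> - ?p \<theta>))\<^sup>2 = (cmod (f \<theta>))\<^sup>2 - 2 * Re (f \<theta> * cnj (?p \<theta>)) + (cmod (?p \<theta>))\<^sup>2" for \<theta>
    unfolding cmod_power2 by (simp add: power2_eq_square algebra_simps)
  have "integrable Tmeas (\<lambda>\<theta>. Re (f \<theta> * cnj (?p \<theta>)))" by (rule integrable_Re[OF i])
  moreover have "integrable Tmeas (\<lambda>\<theta>. (cmod (f \<theta>))\<^sup>2)" "integrable Tmeas (\<lambda>\<theta>. (cmod (?p \<theta>))\<^sup>2)"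
    using f sqint_trig_sum by (auto simp: sqint_def)
  ultimately show ?thesis
    unfolding e using R by (simp add: norm_trig_sum F del: times_complex.sel)
qed

lemma bessel:
  assumes f: "sqint f" and F: "finite F"
  shows "(\<Sum>k\<in>F. (cmod (fcoef f k))\<^sup>2) \<le> (\<integral>\<theta>. (cmod (f \<theta>))\<^sup>2 \<partial>Tmeas)"
proof -
  have "0 \<le> (\<integral>\<theta>. (cmod (f \<theta> - trig_sum F (fcoef f) \<theta>))\<^sup>2 \<partial>Tmeas)"
    by simp
  then show ?thesis unfolding norm_diff_fourier_sum[OF f F] by simp
qed

text \<open>The difference is a trigonometric sum over the symmetric difference, with signs that the
  modulus ignores. Both halves are kept because the finite sets chosen for Riesz-Fischer need not be
  nested.\<close>

lemma norm_diff_trig_sums: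
  assumes F: "finite F" and G: "finite G"
  shows "(\<integral>\<theta>. (cmod (trig_sum F d \<theta> - trig_sum G d \<theta>))\<^sup>2 \<partial>Tmeas) =
    (\<Sum>k\<in>F - G. (cmod (d k))\<^sup>2) + (\<Sum>k\<in>G - F. (cmod (d k))\<^sup>2)"
proof -
  let ?e = "\<lambda>k. if k \<in> F then d k else - d k"
  have "trig_sum F d \<theta> - trig_sum G d \<theta> = trig_sum ((F - G) \<union> (G - F)) ?e \<theta>" for \<theta>
  proof -
    have "trig_sum F d \<theta> = trig_sum (F - G) d \<theta> + trig_sum (F \<inter> G) d \<theta>"
      "trig_sum G d \<theta> = trig_sum (G - F) d \<theta> + trig_sum (F \<inter> G) d \<theta>"
      unfolding trig_sum_def using F G
      by (simp_all add: sum.Int_Diff[of F _ G] sum.Int_Diff[of G _ F] Int_commute)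
    moreover have "trig_sum (F - G) ?e \<theta> = trig_sum (F - G) d \<theta>"
      unfolding trig_sum_def by (rule sum.cong) auto
    moreover have "trig_sum (G - F) ?e \<theta> = - trig_sum (G - F) d \<theta>"
      unfolding trig_sum_def sum_negf[symmetric] by (rule sum.cong) auto
    moreover have "trig_sum ((F - G) \<union> (G - F)) ?e \<theta> = trig_sum (F - G) ?e \<theta> + trig_sum (G - F) ?e \<theta>"
      unfolding trig_sum_def using F G by (intro sum.union_disjoint) auto
    ultimately show ?thesis by simp
  qed
  then have "(\<integral>\<theta>. (cmod (trig_sum F d \<theta> - trig_sum G d \<theta>))\<^sup>2 \<partial>Tmeas) =
      (\<Sum>k\<in>(F - G) \<union> (G - F). (cmod (?e k))\<^sup>2)"
    using norm_trig_sum[of "(F - G) \<union> (G - F)" ?e] F G by simp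
  also have "\<dots> = (\<Sum>k\<in>(F - G) \<union> (G - F). (cmod (d k))\<^sup>2)"
    by (rule sum.cong) auto
  also have "\<dots> = (\<Sum>k\<in>F - G. (cmod (d k))\<^sup>2) + (\<Sum>k\<in>G - F. (cmod (d k))\<^sup>2)"
    using F G by (intro sum.union_disjoint) auto
  finally show ?thesis .
qed

text \<open>Partial sums over rapidly exhausting finite sets converge almost everywhere; Fatou's
  lemma turns this pointwise limit into a limit in L2, and coefficients are continuous in
  L2.\<close>

lemma riesz_fischer:
  assumes d: "(\<lambda>k. (cmod (d k))\<^sup>2) summable_on (UNIV :: int set)"
  shows "\<exists>g. sqint g \<and> fcoef g = d \<and>
    (\<integral>\<theta>. (cmod (g \<theta>))\<^sup>2 \<partial>Tmeas) = (\<Sum>\<^sub>\<infinity>k. (cmod (d k))\<^sup>2)"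
proof -
  define s where "s = (\<Sum>\<^sub>\<infinity>k. (cmod (d k))\<^sup>2)"
  \<comment> \<open>The rate 1/4 for squared norms leaves 1/2 for norms, hence a summable series of
    increments.\<close>
  define \<epsilon> :: "nat \<Rightarrow> real" where "\<epsilon> j = (1/4)^j" for j
  have \<epsilon>0: "0 < \<epsilon> j" and \<epsilon>_mono: "i \<ge> j \<Longrightarrow> \<epsilon> i \<le> \<epsilon> j" for i j
    by (auto simp: \<epsilon>_def power_decreasing)
  have \<epsilon>lim: "\<epsilon> \<longlonglongrightarrow> 0"
    unfolding \<epsilon>_def by (rule LIMSEQ_power_zero) simp
  have le_s: "(\<Sum>k\<in>H. (cmod (d k))\<^sup>2) \<le> s" if "finite H" for H
    unfolding s_def using d that by (intro finite_sum_le_infsum) auto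
  have "\<exists>F. finite F \<and> s - \<epsilon> j \<le> (\<Sum>k\<in>F. (cmod (d k))\<^sup>2)" for j
    using infsum_finite_approximation[OF d \<epsilon>0[of j]]
    by (auto simp: s_def dist_real_def abs_le_iff algebra_simps)
  then obtain F where F: "\<And>j. finite (F j)" "\<And>j. s - \<epsilon> j \<le> (\<Sum>k\<in>F j. (cmod (d k))\<^sup>2)"
    by metis
  \<comment> \<open>\<open>F j\<close> already carries all of \<open>s\<close> except
    \<epsilon>\<open>j\<close>, so little is left for any set disjoint from it.\<close>
  have tail: "(\<Sum>k\<in>H. (cmod (d k))\<^sup>2) \<le> \<epsilon> j" if H: "finite H" "F j \<inter> H = {}" for H j
    using le_s[of "F j \<union> H"] F[of j] H by (simp add: sum.union_disjoint)
  define p where "p j = trig_sum (F j) d" for j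
  have psq: "sqint (p j)" for j by (simp add: p_def sqint_trig_sum)
  then have pm [measurable]: "p j \<in> borel_measurable Tmeas" for j by (simp add: sqint_def)
  have pi: "integrable Tmeas (\<lambda>\<theta>. (cmod (p i \<theta> - p j \<theta>))\<^sup>2)" for i j
    using sqint_diff[OF psq psq] by (simp add: sqint_def)
  \<comment> \<open>The two halves of the symmetric difference contribute at most
    \<epsilon>\<open>j\<close> and \<epsilon>\<open>i\<close>, and the latter is no larger.\<close>
  have pp: "(\<integral>\<theta>. (cmod (p i \<theta> - p j \<theta>))\<^sup>2 \<partial>Tmeas) \<le> 2 * \<epsilon> j" if "i \<ge> j" for i j
    using norm_diff_trig_sums[OF F(1)[of i] F(1)[of j], of d] tail[OF finite_Diff[OF F(1)] Diff_disjoint, of i j] tail[OF finite_Diff[OF F(1)] Diff_disjoint, of j i]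
      \<epsilon>_mono[OF that] by (simp add: p_def)
  have "AE \<theta> in Tmeas. summable (\<lambda>j. cmod (p (Suc j) \<theta> - p j \<theta>))"
  proof -
    have "(\<integral>\<^sup>+\<theta>. ennreal (cmod (p (Suc j) \<theta> - p j \<theta>)) \<partial>Tmeas) \<le> ennreal (3 / 2 * (1/2)^j)" for j
    proof -
      have i: "integrable Tmeas (\<lambda>\<theta>. (2^j * (cmod (p (Suc j) \<theta> - p j \<theta>))\<^sup>2 + (1/2)^j) / 2)"
        using pi by simp
      have "(\<integral>\<^sup>+\<theta>. ennreal (cmod (p (Suc j) \<theta> - p j \<theta>)) \<partial>Tmeas)
          \<le> (\<integral>\<^sup>+\<theta>. ennreal ((2^j * (cmod (p (Suc j) \<theta> - p j \<theta>))\<^sup>2 + (1/2)^j) / 2) \<partial>Tmeas)"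
      proof (intro nn_integral_mono ennreal_leI)
        fix \<theta>
        let ?x = "cmod (p (Suc j) \<theta> - p j \<theta>)"
        \<comment> \<open>A weighted arithmetic-geometric inequality bounds the L1 norm of the
          increment by its squared L2 norm. The weight \<open>2^j\<close> balances the two terms:
          the square is of order \<open>(1/4)^j\<close>, so both become multiples of
          \<open>(1/2)^j\<close>.\<close>
        have "0 \<le> (2^j * ?x - 1)\<^sup>2" by simp
        also have "\<dots> = 2^j * (2^j * ?x\<^sup>2 + (1/2)^j - 2 * ?x)"
          by (simp add: power2_eq_square algebra_simps power_one_over)
        finally have "0 \<le> 2^j * ?x\<^sup>2 + (1/2)^j - 2 * ?x"
          unfolding zero_le_mult_iff using zero_less_power[of "2::real" j] by linarith
        then show "?x \<le> (2^j * ?x\<^sup>2 + (1/2)^j) / 2" by simp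
      qed
      also have "\<dots> = ennreal (\<integral>\<theta>. (2^j * (cmod (p (Suc j) \<theta> - p j \<theta>))\<^sup>2 + (1/2)^j) / 2 \<partial>Tmeas)"
        by (rule nn_integral_eq_integral[OF i]) auto
      also have "(\<integral>\<theta>. (2^j * (cmod (p (Suc j) \<theta> - p j \<theta>))\<^sup>2 + (1/2)^j) / 2 \<partial>Tmeas)
          = (2^j * (\<integral>\<theta>. (cmod (p (Suc j) \<theta> - p j \<theta>))\<^sup>2 \<partial>Tmeas) + (1/2)^j) / 2"
        using pi by (simp add: measure_restrict_space)
      also have "\<dots> \<le> (2^j * (2 * \<epsilon> j) + (1/2)^j) / 2"
        using pp[of j "Suc j"] by (intro divide_right_mono add_right_mono mult_left_mono) auto
      also have "\<dots> = 3 / 2 * (1/2)^j"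
        by (simp add: \<epsilon>_def flip: power_mult_distrib)
      finally show ?thesis by (simp add: ennreal_leI)
    qed
    then have "(\<Sum>j. \<integral>\<^sup>+\<theta>. ennreal (cmod (p (Suc j) \<theta> - p j \<theta>)) \<partial>Tmeas)
        \<le> (\<Sum>j. ennreal (3 / 2 * (1/2)^j))"
      by (intro suminf_le) auto
    also have "\<dots> = ennreal (\<Sum>j. 3 / 2 * (1/2)^j)"
      by (intro suminf_ennreal2 summable_mult summable_geometric) auto
    also have "\<dots> < \<infinity>" by simp
    finally have "(\<integral>\<^sup>+\<theta>. (\<Sum>j. ennreal (cmod (p (Suc j) \<theta> - p j \<theta>))) \<partial>Tmeas) \<noteq> \<infinity>"
      by (subst nn_integral_suminf) auto
    then have "AE \<theta> in Tmeas. (\<Sum>j. ennreal (cmod (p (Suc j) \<theta> - p j \<theta>))) \<noteq> \<infinity>"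
      by (intro nn_integral_PInf_AE) auto
    then show ?thesis
      by eventually_elim (auto intro!: summable_suminf_not_top)
  qed
  then have conv: "AE \<theta> in Tmeas. convergent (\<lambda>j. p j \<theta>)"
  proof eventually_elim
    case (elim \<theta>)
    then have "summable (\<lambda>j. p (Suc j) \<theta> - p j \<theta>)" by (rule summable_norm_cancel)
    then have "convergent (\<lambda>n. p n \<theta> - p 0 \<theta>)"
      by (simp add: summable_iff_convergent sum_lessThan_telescope[of "\<lambda>j. p j \<theta>"])
    then show ?case by (simp add: convergent_diff_const_right_iff)
  qed
  \<comment> \<open>\<open>lim\<close> is total, so \<open>g\<close> is defined and measurable
    everywhere; it is the limit wherever the partial sums converge, that is almost
    everywhere.\<close>
  define g where "g \<theta> = lim (\<lambda>j. p j \<theta>)" for \<theta>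
  have gm [measurable]: "g \<in> borel_measurable Tmeas" unfolding g_def by measurable
  \<comment> \<open>With \<open>j\<close> fixed, the uniform bound \<open>pp\<close> survives the
    limit in \<open>i\<close>.\<close>
  have fatou: "(\<integral>\<^sup>+\<theta>. ennreal ((cmod (g \<theta> - p j \<theta>))\<^sup>2) \<partial>Tmeas) \<le> ennreal (2 * \<epsilon> j)" for j
  proof -
    have "(\<integral>\<^sup>+\<theta>. ennreal ((cmod (g \<theta> - p j \<theta>))\<^sup>2) \<partial>Tmeas)
        = (\<integral>\<^sup>+\<theta>. liminf (\<lambda>i. ennreal ((cmod (p i \<theta> - p j \<theta>))\<^sup>2)) \<partial>Tmeas)"
    proof (rule nn_integral_cong_AE)
      show "AE \<theta> in Tmeas. ennreal ((cmod (g \<theta> - p j \<theta>))\<^sup>2) =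
          liminf (\<lambda>i. ennreal ((cmod (p i \<theta> - p j \<theta>))\<^sup>2))"
        using conv
      proof eventually_elim
        case (elim \<theta>)
        then have "(\<lambda>i. p i \<theta>) \<longlonglongrightarrow> g \<theta>"
          by (simp add: g_def convergent_LIMSEQ_iff)
        then have "(\<lambda>i. ennreal ((cmod (p i \<theta> - p j \<theta>))\<^sup>2)) \<longlonglongrightarrow> ennreal ((cmod (g \<theta> - p j \<theta>))\<^sup>2)"
          by (intro tendsto_intros)
        then show ?case by (intro lim_imp_Liminf[symmetric]) auto
      qed
    qed
    also have "\<dots> \<le> liminf (\<lambda>i. \<integral>\<^sup>+\<theta>. ennreal ((cmod (p i \<theta> - p j \<theta>))\<^sup>2) \<partial>Tmeas)"
      by (rule nn_integral_liminf) measurable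
    also have "\<dots> \<le> ennreal (2 * \<epsilon> j)"
    proof (rule Liminf_le)
      show "\<forall>\<^sub>F i in sequentially. (\<integral>\<^sup>+\<theta>. ennreal ((cmod (p i \<theta> - p j \<theta>))\<^sup>2) \<partial>Tmeas) \<le> ennreal (2 * \<epsilon> j)"
        using eventually_ge_at_top[of j]
        by eventually_elim (simp add: nn_integral_eq_integral[OF pi] ennreal_leI pp)
    qed simp
    finally show ?thesis .
  qed
  have gpsq: "sqint (\<lambda>\<theta>. g \<theta> - p j \<theta>)" for j
    unfolding sqint_def
  proof
    show "integrable Tmeas (\<lambda>\<theta>. (cmod (g \<theta> - p j \<theta>))\<^sup>2)"
      by (rule integrableI_nonneg) (use fatou[of j] in \<open>auto simp: le_less_trans\<close>)
  qed measurable
  then have gp: "(\<integral>\<theta>. (cmod (g \<theta> - p j \<theta>))\<^sup>2 \<partial>Tmeas) \<le> 2 * \<epsilon> j" for j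
    using fatou[of j] \<epsilon>0[of j] nn_integral_eq_integral[of Tmeas "\<lambda>\<theta>. (cmod (g \<theta> - p j \<theta>))\<^sup>2"]
    by (simp add: sqint_def)
  have gsq: "sqint g"
    using sqint_add[OF gpsq[of 0] psq[of 0]] by simp
  have coef: "fcoef g k = d k" for k
  proof -
    \<comment> \<open>The factor 6 is 2 * 2 + 2 * 1: squared errors 2 \<epsilon>\<open>j\<close>
      from Bessel's inequality for \<open>g - p j\<close> and \<epsilon>\<open>j\<close> from the
      tail, each doubled by the split of the square.\<close>
    have b: "(cmod (fcoef g k - d k))\<^sup>2 \<le> 6 * \<epsilon> j" for j
    proof -
      have "(cmod (fcoef g k - fcoef (p j) k))\<^sup>2 \<le> 2 * \<epsilon> j"
        using bessel[OF gpsq[of j], of "{k}"] gp[of j]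
        by (simp add: fcoef_diff sqint_integrable gsq psq)
      moreover have "(cmod (fcoef (p j) k - d k))\<^sup>2 \<le> \<epsilon> j"
        using tail[of "{k}" j] \<epsilon>0[of j] by (auto simp: p_def fcoef_trig_sum F(1))
      moreover have "(cmod ((fcoef g k - fcoef (p j) k) + (fcoef (p j) k - d k)))\<^sup>2
          \<le> 2 * (cmod (fcoef g k - fcoef (p j) k))\<^sup>2 + 2 * (cmod (fcoef (p j) k - d k))\<^sup>2"
        by (rule norm_add_square_le)
      ultimately show ?thesis by simp
    qed
    have "(\<lambda>j. 6 * \<epsilon> j) \<longlonglongrightarrow> 6 * 0" by (intro tendsto_intros \<epsilon>lim)
    then have "(cmod (fcoef g k - d k))\<^sup>2 \<le> 6 * 0"
      by (rule LIMSEQ_le_const) (use b in blast)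
    then show ?thesis by simp
  qed
  then have fg: "fcoef g = d" by (rule ext)
  have "(\<integral>\<theta>. (cmod (g \<theta>))\<^sup>2 \<partial>Tmeas) = s"
  proof -
    \<comment> \<open>As \<open>g\<close> has coefficients \<open>d\<close>, the function
      \<open>p j\<close> is its Fourier sum over \<open>F j\<close>. The exact remainder then
      squeezes the squared norm of \<open>g\<close> against the same finite sum that approximates
      \<open>s\<close>.\<close>
    have "\<bar>(\<integral>\<theta>. (cmod (g \<theta>))\<^sup>2 \<partial>Tmeas) - s\<bar> \<le> 2 * \<epsilon> j" for j
      using norm_diff_fourier_sum[OF gsq F(1)[of j]] gp[of j] F(2)[of j] le_s[OF F(1)[of j]]
        bessel[OF gsq F(1)[of j]] \<epsilon>0[of j]
      by (simp add: fg p_def[symmetric] abs_le_iff)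
    moreover have "(\<lambda>j. 2 * \<epsilon> j) \<longlonglongrightarrow> 2 * 0" by (intro tendsto_intros \<epsilon>lim)
    ultimately have "\<bar>(\<integral>\<theta>. (cmod (g \<theta>))\<^sup>2 \<partial>Tmeas) - s\<bar> \<le> 2 * 0"
      by (intro LIMSEQ_le_const) blast+
    then show ?thesis by simp
  qed
  then show ?thesis using gsq fg unfolding s_def by blast
qed

text \<open>Completeness enters here: Riesz-Fischer yields a function with the coefficients of
  \<open>f\<close> and the right norm, and uniqueness identifies it with \<open>f\<close> almost
  everywhere.\<close>

lemma
  assumes f: "sqint f"
  shows fcoef_square_summable: "(\<lambda>k. (cmod (fcoef f k))\<^sup>2) summable_on UNIV"
    and parseval: "(\<Sum>\<^sub>\<infinity>k. (cmod (fcoef f k))\<^sup>2) = (\<integral>\<theta>. (cmod (f \<theta>))\<^sup>2 \<partial>Tmeas)"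
proof -
  show s: "(\<lambda>k. (cmod (fcoef f k))\<^sup>2) summable_on UNIV"
    by (rule nonneg_bdd_above_summable_on) (auto simp: bdd_above_def intro: bessel[OF f])
  obtain g where g: "sqint g" "fcoef g = fcoef f"
    "(\<integral>\<theta>. (cmod (g \<theta>))\<^sup>2 \<partial>Tmeas) = (\<Sum>\<^sub>\<infinity>k. (cmod (fcoef f k))\<^sup>2)"
    using riesz_fischer[OF s] by auto
  have "AE \<theta> in Tmeas. f \<theta> - g \<theta> = 0"
    by (rule fcoef_unique) (use f g in \<open>auto simp: fcoef_diff sqint_integrable\<close>)
  then have "(\<integral>\<theta>. (cmod (f \<theta>))\<^sup>2 \<partial>Tmeas) = (\<integral>\<theta>. (cmod (g \<theta>))\<^sup>2 \<partial>Tmeas)"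
    using f g by (intro integral_cong_AE) (auto simp: sqint_def)
  then show "(\<Sum>\<^sub>\<infinity>k. (cmod (fcoef f k))\<^sup>2) = (\<integral>\<theta>. (cmod (f \<theta>))\<^sup>2 \<partial>Tmeas)"
    using g by simp
qed

section \<open>Sums over index sets as integrals against counting measure\<close>

lemma
  fixes h :: "'a \<Rightarrow> real"
  assumes h: "\<And>x. 0 \<le> h x"
  shows nn_integral_count_space_finite_iff:
      "(\<integral>\<^sup>+x. ennreal (h x) \<partial>count_space UNIV) < \<infinity> \<longleftrightarrow> h summable_on UNIV"
    and infsum_eq_nn_integral_count_space:
      "(\<Sum>\<^sub>\<infinity>x. h x) = enn2real (\<integral>\<^sup>+x. ennreal (h x) \<partial>count_space UNIV)"
proof -
  have "integrable (count_space UNIV) h \<longleftrightarrow> (\<lambda>x. norm (h x)) summable_on UNIV"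
    unfolding abs_summable_equivalent Infinite_Set_Sum.abs_summable_on_def ..
  then have i: "integrable (count_space UNIV) h \<longleftrightarrow> h summable_on UNIV"
    using h by simp
  then show *: "(\<integral>\<^sup>+x. ennreal (h x) \<partial>count_space UNIV) < \<infinity> \<longleftrightarrow> h summable_on UNIV"
    using h by (simp add: integrable_iff_bounded)
  show "(\<Sum>\<^sub>\<infinity>x. h x) = enn2real (\<integral>\<^sup>+x. ennreal (h x) \<partial>count_space UNIV)"
  proof (cases "h summable_on UNIV")
    case True
    then have "infsetsum h UNIV = infsum h UNIV"
      using i by (intro infsetsum_infsum) (simp add: Infinite_Set_Sum.abs_summable_on_def)
    moreover have "infsetsum h UNIV = enn2real (\<integral>\<^sup>+x. ennreal (h x) \<partial>count_space UNIV)"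
      by (rule infsetsum_conv_nn_integral) (use * True h in auto)
    ultimately show ?thesis by simp
  next
    case False
    \<comment> \<open>The default values agree: \<open>enn2real\<close> sends \<open>top\<close> to
      0, which is also the value of a divergent \<open>infsum\<close>.\<close>
    then have "(\<integral>\<^sup>+x. ennreal (h x) \<partial>count_space UNIV) = top"
      using * by (simp add: less_top[symmetric])
    with False show ?thesis by (simp add: infsum_not_exists)
  qed
qed

lemma parseval_nn_integral:
  assumes f: "sqint f"
  shows "(\<integral>\<^sup>+\<theta>. ennreal ((cmod (f \<theta>))\<^sup>2) \<partial>Tmeas) =
    (\<integral>\<^sup>+k. ennreal ((cmod (fcoef f k))\<^sup>2) \<partial>count_space UNIV)"
proof -
  have "(\<integral>\<^sup>+\<theta>. ennreal ((cmod (f \<theta>))\<^sup>2) \<partial>Tmeas) = ennreal (\<integral>\<theta>. (cmod (f \<theta>))\<^sup>2 \<partial>Tmeas)"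
    using f by (intro nn_integral_eq_integral) (auto simp: sqint_def)
  also have "\<dots> = ennreal (\<Sum>\<^sub>\<infinity>k. (cmod (fcoef f k))\<^sup>2)"
    by (simp only: parseval[OF f])
  also have "\<dots> = (\<integral>\<^sup>+k. ennreal ((cmod (fcoef f k))\<^sup>2) \<partial>count_space UNIV)"
    using fcoef_square_summable[OF f]
    by (subst infsum_eq_nn_integral_count_space) (simp_all flip: nn_integral_count_space_finite_iff)
  finally show ?thesis .
qed

section \<open>Aubry duality on the direct integral\<close>

text \<open>The squared norm with values in \<open>ennreal\<close>, so that finiteness can decide
  membership. The sum over the basis stands outside, which lets Parseval's identity be applied to
  each component.\<close>

definition di_nn :: "(real \<Rightarrow> idx \<Rightarrow> complex) \<Rightarrow> ennreal" where
  "di_nn f = (\<integral>\<^sup>+x. \<integral>\<^sup>+\<theta>. ennreal ((cmod (f \<theta> x))\<^sup>2) \<partial>Tmeas \<partial>count_space UNIV)"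

definition di_coef :: "(real \<Rightarrow> idx \<Rightarrow> complex) \<Rightarrow> idx \<Rightarrow> int \<Rightarrow> complex" where
  "di_coef f x = fcoef (\<lambda>\<theta>. f \<theta> x)"

definition l2_nn :: "(idx \<Rightarrow> int \<Rightarrow> complex) \<Rightarrow> ennreal" where
  "l2_nn c = (\<integral>\<^sup>+x. \<integral>\<^sup>+k. ennreal ((cmod (c x k))\<^sup>2) \<partial>count_space UNIV \<partial>count_space UNIV)"

lemma fib_sq_eq_nn_integral:
  "fib_sq \<psi> = enn2real (\<integral>\<^sup>+x. ennreal ((cmod (\<psi> x))\<^sup>2) \<partial>count_space UNIV)"
  unfolding fib_sq_def by (rule infsum_eq_nn_integral_count_space) simp

lemma borel_measurable_nn_integral_count_space:
  assumes [measurable]: "\<And>x :: 'i. f x \<in> borel_measurable M"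
    and I: "countable (UNIV :: 'i set)" "infinite (UNIV :: 'i set)"
  shows "(\<lambda>\<theta>. \<integral>\<^sup>+x. f x \<theta> \<partial>count_space UNIV) \<in> borel_measurable M"
proof -
  have "(\<integral>\<^sup>+x. f x \<theta> \<partial>count_space UNIV) = (\<Sum>i. f (from_nat_into UNIV i) \<theta>)" for \<theta>
    using nn_integral_bij_count_space[OF bij_betw_from_nat_into[OF I], of "\<lambda>x. f x \<theta>"]
    by (simp add: nn_integral_count_space_nat)
  then show ?thesis by simp
qed

text \<open>Tonelli exchanges the sum over the basis with the integral over \<theta>, linking the
  fibrewise definition of the space to the componentwise norm \<open>di_nn\<close>.\<close>

lemma
  assumes m: "\<And>x. (\<lambda>\<theta>. f \<theta> x) \<in> borel_measurable Tmeas"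
  shows DI_space_iff: "f \<in> DI_space \<longleftrightarrow> di_nn f < \<infinity>"
    and di_norm2_eq: "di_nn f < \<infinity> \<Longrightarrow> di_norm2 f = enn2real (di_nn f)"
proof -
  define E where "E \<theta> = (\<integral>\<^sup>+x. ennreal ((cmod (f \<theta> x))\<^sup>2) \<partial>count_space UNIV)" for \<theta>
  have "infinite (UNIV :: idx set)"
    by (simp add: finite_prod)
  then have Em [measurable]: "E \<in> borel_measurable Tmeas"
    unfolding E_def[abs_def] using m by (intro borel_measurable_nn_integral_count_space) auto
  have fib: "fib_sq (f \<theta>) = enn2real (E \<theta>)" for \<theta>
    by (simp add: E_def fib_sq_eq_nn_integral)
  have summ: "(\<lambda>x. (cmod (f \<theta> x))\<^sup>2) summable_on UNIV \<longleftrightarrow> E \<theta> < \<infinity>" for \<theta>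
    unfolding E_def by (rule nn_integral_count_space_finite_iff[symmetric]) simp
  have nn: "(\<integral>\<^sup>+\<theta>. E \<theta> \<partial>Tmeas) = di_nn f"
    unfolding E_def di_nn_def using m by (intro nn_integral_count_space_nn_integral) auto
  have eq: "(\<integral>\<^sup>+\<theta>. ennreal (fib_sq (f \<theta>)) \<partial>Tmeas) = di_nn f" if "AE \<theta> in Tmeas. E \<theta> < \<infinity>"
    unfolding nn[symmetric] fib
    by (rule nn_integral_cong_AE) (use that in \<open>eventually_elim, simp\<close>)
  \<comment> \<open>A finite integral forces finite fibre norms almost everywhere; the value 0 that
    \<open>fib_sq\<close> assigns to a divergent fibre then occurs only on a null set.\<close>
  have fin: "AE \<theta> in Tmeas. E \<theta> < \<infinity>" if "di_nn f < \<infinity>"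
  proof -
    have "AE \<theta> in Tmeas. E \<theta> \<noteq> \<infinity>"
      by (rule nn_integral_PInf_AE[OF Em]) (use that nn in simp)
    then show ?thesis by eventually_elim (simp add: less_top)
  qed
  have fm: "(\<lambda>\<theta>. fib_sq (f \<theta>)) \<in> borel_measurable Tmeas"
    unfolding fib by measurable
  have nonneg: "0 \<le> fib_sq (f \<theta>)" for \<theta> by (simp add: fib)
  show "f \<in> DI_space \<longleftrightarrow> di_nn f < \<infinity>"
  proof
    assume "f \<in> DI_space"
    then have "AE \<theta> in Tmeas. E \<theta> < \<infinity>" and i: "integrable Tmeas (\<lambda>\<theta>. fib_sq (f \<theta>))"
      by (auto simp: DI_space_def summ)
    with eq nn_integral_eq_integral[OF i] nonneg
    have "di_nn f = ennreal (\<integral>\<theta>. fib_sq (f \<theta>) \<partial>Tmeas)" by simp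
    then show "di_nn f < \<infinity>" by simp
  next
    assume d: "di_nn f < \<infinity>"
    have "integrable Tmeas (\<lambda>\<theta>. fib_sq (f \<theta>))"
      using d eq[OF fin[OF d]] nonneg by (intro integrableI_nonneg fm) auto
    then show "f \<in> DI_space"
      using m fin[OF d] by (simp add: DI_space_def summ)
  qed
  show "di_norm2 f = enn2real (di_nn f)" if d: "di_nn f < \<infinity>"
    unfolding di_norm2_def
    by (subst integral_eq_nn_integral[OF fm]) (use nonneg eq[OF fin[OF d]] in auto)
qed

lemma DI_space_measurable: "f \<in> DI_space \<Longrightarrow> (\<lambda>\<theta>. f \<theta> x) \<in> borel_measurable Tmeas"
  unfolding DI_space_def by blast

lemma DI_space_sqint:
  assumes "f \<in> DI_space" shows "sqint (\<lambda>\<theta>. f \<theta> x)"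
  unfolding sqint_def
proof
  have m: "(\<lambda>\<theta>. f \<theta> x) \<in> borel_measurable Tmeas" for x
    by (rule DI_space_measurable[OF assms])
  show "(\<lambda>\<theta>. f \<theta> x) \<in> borel_measurable Tmeas" by (rule m)
  have "(\<integral>\<^sup>+\<theta>. ennreal ((cmod (f \<theta> x))\<^sup>2) \<partial>Tmeas) \<le> di_nn f"
    unfolding di_nn_def
    by (rule nn_integral_ge_point[of x UNIV "\<lambda>x. \<integral>\<^sup>+\<theta>. ennreal ((cmod (f \<theta> x))\<^sup>2) \<partial>Tmeas"]) simp
  also have "\<dots> < \<infinity>" using assms DI_space_iff[of f, OF m] by blast
  finally show "integrable Tmeas (\<lambda>\<theta>. (cmod (f \<theta> x))\<^sup>2)"
    using m by (intro integrableI_nonneg) auto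
qed

lemma DI_space_integrable: "f \<in> DI_space \<Longrightarrow> integrable Tmeas (\<lambda>\<theta>. f \<theta> x)"
  by (intro sqint_integrable DI_space_sqint)

lemma DI_spaceI:
  assumes "\<And>x. sqint (\<lambda>\<theta>. f \<theta> x)" "di_nn f < \<infinity>"
  shows "f \<in> DI_space"
  using assms DI_space_iff[of f] by (simp add: sqint_def)

lemma DI_space_nn_finite:
  assumes "f \<in> DI_space" shows "di_nn f < \<infinity>"
  using assms DI_space_iff[of f] DI_space_sqint[OF assms] by (simp add: sqint_def)

lemma di_nn_eq_l2_nn:
  assumes "\<And>x. sqint (\<lambda>\<theta>. f \<theta> x)"
  shows "di_nn f = l2_nn (di_coef f)"
  using assms by (simp add: di_nn_def l2_nn_def di_coef_def parseval_nn_integral)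

lemma l2_nn_di_coef_finite: "f \<in> DI_space \<Longrightarrow> l2_nn (di_coef f) < \<infinity>"
  using di_nn_eq_l2_nn DI_space_nn_finite DI_space_sqint by metis

lemma di_norm2_eq_l2_nn:
  assumes "f \<in> DI_space" shows "di_norm2 f = enn2real (l2_nn (di_coef f))"
  using di_norm2_eq[OF DI_space_measurable DI_space_nn_finite] di_nn_eq_l2_nn[OF DI_space_sqint] assms
  by simp

text \<open>Riesz-Fischer is applied to each basis index separately; Parseval's identity then puts
  the assembled function into the space.\<close>

lemma ex_di_coef:
  assumes c: "l2_nn c < \<infinity>"
  shows "\<exists>f\<in>DI_space. di_coef f = c"
proof -
  have "\<exists>g. sqint g \<and> fcoef g = c x" for x
  proof -
    have "(\<integral>\<^sup>+k. ennreal ((cmod (c x k))\<^sup>2) \<partial>count_space UNIV) \<le> l2_nn c"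
      unfolding l2_nn_def
      by (rule nn_integral_ge_point[of x UNIV "\<lambda>x. \<integral>\<^sup>+k. ennreal ((cmod (c x k))\<^sup>2) \<partial>count_space UNIV"]) simp
    then have "(\<integral>\<^sup>+k. ennreal ((cmod (c x k))\<^sup>2) \<partial>count_space UNIV) < \<infinity>"
      using c by (rule le_less_trans)
    then have "(\<lambda>k. (cmod (c x k))\<^sup>2) summable_on UNIV"
      by (subst (asm) nn_integral_count_space_finite_iff) auto
    then show ?thesis using riesz_fischer by blast
  qed
  then obtain g where g: "\<And>x. sqint (g x)" "\<And>x. fcoef (g x) = c x" by metis
  define f where "f \<theta> x = g x \<theta>" for \<theta> x
  have s: "sqint (\<lambda>\<theta>. f \<theta> x)" for x using g by (simp add: f_def)
  have "di_coef f = c" by (rule ext) (simp add: di_coef_def f_def g)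
  with di_nn_eq_l2_nn[OF s] c have "f \<in> DI_space"
    by (intro DI_spaceI s) simp
  with \<open>di_coef f = c\<close> show ?thesis by blast
qed

text \<open>The bridge to pure algebra. There are only countably many basis indices, so the
  exceptional null sets of the components can be united.\<close>

lemma di_eq_iff_di_coef:
  assumes f: "f \<in> DI_space" and g: "g \<in> DI_space"
  shows "di_eq f g \<longleftrightarrow> di_coef f = di_coef g"
proof
  assume e: "di_eq f g"
  have "fcoef (\<lambda>\<theta>. f \<theta> x) k = fcoef (\<lambda>\<theta>. g \<theta> x) k" for x k
    unfolding fcoef_def
  proof (rule integral_cong_AE)
    show "(\<lambda>\<theta>. f \<theta> x * trig (- k) \<theta>) \<in> borel_measurable Tmeas"
      "(\<lambda>\<theta>. g \<theta> x * trig (- k) \<theta>) \<in> borel_measurable Tmeas"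
      using DI_space_integrable[OF f, of x] DI_space_integrable[OF g, of x]
      by (auto intro: borel_measurable_integrable integrable_mult_trig)
    show "AE \<theta> in Tmeas. f \<theta> x * trig (- k) \<theta> = g \<theta> x * trig (- k) \<theta>"
      using e unfolding di_eq_def by eventually_elim simp
  qed
  then show "di_coef f = di_coef g" by (intro ext) (simp add: di_coef_def)
next
  assume c: "di_coef f = di_coef g"
  have "AE \<theta> in Tmeas. f \<theta> x = g \<theta> x" for x
  proof -
    have "AE \<theta> in Tmeas. f \<theta> x - g \<theta> x = 0"
    proof (rule fcoef_unique)
      show "integrable Tmeas (\<lambda>\<theta>. f \<theta> x - g \<theta> x)"
        using DI_space_integrable[OF f] DI_space_integrable[OF g] by simp
      show "fcoef (\<lambda>\<theta>. f \<theta> x - g \<theta> x) k = 0" for k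
        using fun_cong[OF c, of x] DI_space_integrable[OF f] DI_space_integrable[OF g]
        by (simp add: fcoef_diff di_coef_def)
    qed
    then show ?thesis by eventually_elim simp
  qed
  then have "AE \<theta> in Tmeas. \<forall>x. f \<theta> x = g \<theta> x" by (simp add: AE_all_countable)
  then show "di_eq f g" unfolding di_eq_def by eventually_elim (simp add: fun_eq_iff)
qed

text \<open>Linear combinations, \<open>S\<close>, \<open>Q\<close> and the transposes all have this
  shape: two components moved by bijections and multiplied by bounded functions. Stability of the
  space is thus proved once; the factor \<open>2 * B\<^sup>2\<close> comes from squaring a sum of
  two terms.\<close>

lemma DI_space_two_term:
  assumes f: "f1 \<in> DI_space" "f2 \<in> DI_space" and bij: "bij \<pi>1" "bij \<pi>2"
    and g [measurable]: "\<And>x. (\<lambda>\<theta>. g1 \<theta> x) \<in> borel_measurable Tmeas"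
      "\<And>x. (\<lambda>\<theta>. g2 \<theta> x) \<in> borel_measurable Tmeas"
    and b: "\<And>\<theta> x. cmod (g1 \<theta> x) \<le> B" "\<And>\<theta> x. cmod (g2 \<theta> x) \<le> B"
  shows "(\<lambda>\<theta> x. g1 \<theta> x * f1 \<theta> (\<pi>1 x) + g2 \<theta> x * f2 \<theta> (\<pi>2 x)) \<in> DI_space"
proof -
  let ?h = "\<lambda>\<theta> x. g1 \<theta> x * f1 \<theta> (\<pi>1 x) + g2 \<theta> x * f2 \<theta> (\<pi>2 x)"
  let ?I = "\<lambda>f x. \<integral>\<^sup>+\<theta>. ennreal ((cmod (f \<theta> x))\<^sup>2) \<partial>Tmeas"
  have [measurable]: "(\<lambda>\<theta>. f1 \<theta> x) \<in> borel_measurable Tmeas"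
    "(\<lambda>\<theta>. f2 \<theta> x) \<in> borel_measurable Tmeas" for x
    using f by (auto intro: DI_space_measurable)
  have pw: "(cmod (?h \<theta> x))\<^sup>2 \<le> 2 * B\<^sup>2 * ((cmod (f1 \<theta> (\<pi>1 x)))\<^sup>2 + (cmod (f2 \<theta> (\<pi>2 x)))\<^sup>2)" for \<theta> x
  proof -
    have "(cmod (g1 \<theta> x))\<^sup>2 \<le> B\<^sup>2" "(cmod (g2 \<theta> x))\<^sup>2 \<le> B\<^sup>2"
      by (intro power_mono b norm_ge_zero)+
    then have "(cmod (g1 \<theta> x))\<^sup>2 * (cmod (f1 \<theta> (\<pi>1 x)))\<^sup>2 \<le> B\<^sup>2 * (cmod (f1 \<theta> (\<pi>1 x)))\<^sup>2"
      "(cmod (g2 \<theta> x))\<^sup>2 * (cmod (f2 \<theta> (\<pi>2 x)))\<^sup>2 \<le> B\<^sup>2 * (cmod (f2 \<theta> (\<pi>2 x)))\<^sup>2"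
      by (auto intro: mult_right_mono)
    then show ?thesis
      using norm_add_square_le[of "g1 \<theta> x * f1 \<theta> (\<pi>1 x)" "g2 \<theta> x * f2 \<theta> (\<pi>2 x)"]
      by (simp add: norm_mult power_mult_distrib algebra_simps)
  qed
  have "?I ?h x \<le> ennreal (2 * B\<^sup>2) * (?I f1 (\<pi>1 x) + ?I f2 (\<pi>2 x))" for x
  proof -
    have "?I ?h x \<le> (\<integral>\<^sup>+\<theta>. ennreal (2 * B\<^sup>2) * (ennreal ((cmod (f1 \<theta> (\<pi>1 x)))\<^sup>2)
        + ennreal ((cmod (f2 \<theta> (\<pi>2 x)))\<^sup>2)) \<partial>Tmeas)"
      using pw by (intro nn_integral_mono)
        (simp add: ennreal_leI flip: ennreal_plus ennreal_mult')
    also have "\<dots> = ennreal (2 * B\<^sup>2) * (?I f1 (\<pi>1 x) + ?I f2 (\<pi>2 x))"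
      by (simp add: nn_integral_cmult nn_integral_add)
    finally show ?thesis .
  qed
  then have "di_nn ?h \<le> (\<integral>\<^sup>+x. ennreal (2 * B\<^sup>2) * (?I f1 (\<pi>1 x) + ?I f2 (\<pi>2 x)) \<partial>count_space UNIV)"
    unfolding di_nn_def by (intro nn_integral_mono)
  also have "\<dots> = ennreal (2 * B\<^sup>2) * (di_nn f1 + di_nn f2)"
    using nn_integral_bij_count_space[OF bij(1), of "?I f1"]
      nn_integral_bij_count_space[OF bij(2), of "?I f2"]
    by (simp add: nn_integral_cmult nn_integral_add di_nn_def)
  also have "\<dots> < \<infinity>"
    using f by (simp add: DI_space_nn_finite[unfolded infinity_ennreal_def] ennreal_mult_less_top)
  finally show ?thesis
    by (subst DI_space_iff) measurable
qed

section \<open>The duality map on Fourier coefficients\<close>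

definition qphase :: "real \<Rightarrow> int \<Rightarrow> complex" where
  "qphase \<Phi> n = cis (2 * pi * of_int n * \<Phi>)"

lemma qphase_add: "qphase \<Phi> (m + n) = qphase \<Phi> m * qphase \<Phi> n"
  by (simp add: qphase_def cis_mult algebra_simps)

lemma qphase_0 [simp]: "qphase \<Phi> 0 = 1"
  by (simp add: qphase_def)

lemma norm_qphase [simp]: "cmod (qphase \<Phi> n) = 1"
  by (simp add: qphase_def)

lemma qphase_minus_cancel [simp]: "qphase \<Phi> n * qphase \<Phi> (- n) = 1"
  by (simp flip: qphase_add)

text \<open>With \<open>T\<close> the shift in \<open>n\<close> and \<open>V\<close> the multiplication by
  \<open>exp (2 \<pi> \<i> (n \<Phi> + \<theta>))\<close>, the phase and the index map \<open>(n, k) \<mapsto> (k, - n)\<close> in \<open>dual\<close>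
  are forced by \<open>dual T = V dual\<close> and \<open>dual V = T\<^sup>-\<^sup>1 dual\<close>; the spin factor is
  \<open>(1 + \<i> \<sigma>\<^sub>x) / sqrt 2\<close>.\<close>

definition dual :: "real \<Rightarrow> (idx \<Rightarrow> int \<Rightarrow> complex) \<Rightarrow> idx \<Rightarrow> int \<Rightarrow> complex" where
  "dual \<Phi> c = (\<lambda>(n, s) k. qphase \<Phi> (n * k) * (c (k, s) (- n) + \<i> * c (k, \<not> s) (- n)) / sqrt 2)"

definition dual_inv :: "real \<Rightarrow> (idx \<Rightarrow> int \<Rightarrow> complex) \<Rightarrow> idx \<Rightarrow> int \<Rightarrow> complex" where
  "dual_inv \<Phi> d = (\<lambda>(m, s) j. qphase \<Phi> (j * m) * (d (- j, s) m - \<i> * d (- j, \<not> s) m) / sqrt 2)"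

lemma sqrt2_mult_self: "complex_of_real (sqrt 2) * complex_of_real (sqrt 2) = 2"
  by (simp flip: of_real_mult)

text \<open>This composition yields surjectivity of the duality; the isometry
  \<open>l2_nn_dual\<close> complements it.\<close>

lemma dual_dual_inv: "dual \<Phi> (dual_inv \<Phi> d) = d"
proof (intro ext)
  fix x :: idx and k
  obtain n s where x: "x = (n, s)" by force
  show "dual \<Phi> (dual_inv \<Phi> d) x k = d x k"
    by (simp add: x dual_def dual_inv_def sqrt2_mult_self add_divide_distrib[symmetric]
        distrib_left[symmetric] algebra_simps)
qed

lemma dual_linear:
  "dual \<Phi> (\<lambda>x k. a * c x k + b * d x k) = (\<lambda>x k. a * dual \<Phi> c x k + b * dual \<Phi> d x k)"
  by (intro ext) (auto simp: dual_def field_simps)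

text \<open>\<open>dual\<close> permutes the pairs of position and frequency but mixes the two spins
  over each pair, so the norm is regrouped with both spins in one summand.\<close>

lemma l2_nn_eq_pairs:
  "l2_nn c = (\<integral>\<^sup>+p. ennreal ((cmod (c (fst p, True) (snd p)))\<^sup>2 + (cmod (c (fst p, False) (snd p)))\<^sup>2)
    \<partial>count_space (UNIV :: (int \<times> int) set))"
proof -
  have "l2_nn c = (\<integral>\<^sup>+n. \<integral>\<^sup>+s. \<integral>\<^sup>+k. ennreal ((cmod (c (n, s) k))\<^sup>2)
      \<partial>count_space UNIV \<partial>count_space UNIV \<partial>count_space UNIV)"
    unfolding l2_nn_def by (subst nn_integral_fst_count_space[symmetric]) simp
  also have "\<dots> = (\<integral>\<^sup>+n. \<integral>\<^sup>+k. ennreal ((cmod (c (n, True) k))\<^sup>2 + (cmod (c (n, False) k))\<^sup>2)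
      \<partial>count_space UNIV \<partial>count_space UNIV)"
    by (simp add: nn_integral_count_space_finite UNIV_bool add.commute nn_integral_add)
  also have "\<dots> = (\<integral>\<^sup>+p. ennreal ((cmod (c (fst p, True) (snd p)))\<^sup>2 + (cmod (c (fst p, False) (snd p)))\<^sup>2)
    \<partial>count_space UNIV)"
    by (subst nn_integral_fst_count_space[symmetric]) simp
  finally show ?thesis .
qed

text \<open>The phases are unimodular, the spin factor is unitary by the parallelogram identity
  \<open>par\<close>, and the index map is a bijection of pairs.\<close>

lemma l2_nn_dual: "l2_nn (dual \<Phi> c) = l2_nn c"
proof -
  have par: "(cmod (z + \<i> * w))\<^sup>2 + (cmod (w + \<i> * z))\<^sup>2 = 2 * ((cmod z)\<^sup>2 + (cmod w)\<^sup>2)" for z w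
    unfolding cmod_power2 by (simp add: power2_eq_square algebra_simps)
  have bij: "bij (\<lambda>p :: int \<times> int. (snd p, - fst p))"
    by (rule bij_betw_byWitness[where f' = "\<lambda>p. (- snd p, fst p)"]) auto
  have "(cmod (dual \<Phi> c (n, True) k))\<^sup>2 + (cmod (dual \<Phi> c (n, False) k))\<^sup>2
      = (cmod (c (k, True) (- n)))\<^sup>2 + (cmod (c (k, False) (- n)))\<^sup>2" for n k
    using par[of "c (k, True) (- n)" "c (k, False) (- n)"]
    by (simp add: dual_def norm_mult norm_divide power_mult_distrib power_divide)
  then have "l2_nn (dual \<Phi> c) = (\<integral>\<^sup>+p. ennreal ((cmod (c (snd p, True) (- fst p)))\<^sup>2
      + (cmod (c (snd p, False) (- fst p)))\<^sup>2) \<partial>count_space UNIV)"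
    unfolding l2_nn_eq_pairs by simp
  also have "\<dots> = l2_nn c"
    unfolding l2_nn_eq_pairs
    using nn_integral_bij_count_space[OF bij, of "\<lambda>p. ennreal ((cmod (c (fst p, True) (snd p)))\<^sup>2
      + (cmod (c (fst p, False) (snd p)))\<^sup>2)"] by simp
  finally show ?thesis .
qed

text \<open>Coefficients fix a function only up to a null set, so a representative is chosen. For
  this reason linearity and all later identities hold modulo \<open>di_eq\<close>.\<close>

definition dualize :: "real \<Rightarrow> (real \<Rightarrow> idx \<Rightarrow> complex) \<Rightarrow> real \<Rightarrow> idx \<Rightarrow> complex" where
  "dualize \<Phi> f = (SOME g. g \<in> DI_space \<and> di_coef g = dual \<Phi> (di_coef f))"

lemma
  assumes "f \<in> DI_space"
  shows dualize_in_DI_space: "dualize \<Phi> f \<in> DI_space"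
    and di_coef_dualize: "di_coef (dualize \<Phi> f) = dual \<Phi> (di_coef f)"
proof -
  have "\<exists>g. g \<in> DI_space \<and> di_coef g = dual \<Phi> (di_coef f)"
    using ex_di_coef[of "dual \<Phi> (di_coef f)"] l2_nn_di_coef_finite[OF assms]
    by (auto simp: l2_nn_dual)
  from someI_ex[OF this]
  show "dualize \<Phi> f \<in> DI_space" "di_coef (dualize \<Phi> f) = dual \<Phi> (di_coef f)"
    by (simp_all add: dualize_def)
qed

lemma DI_space_linear:
  assumes "f \<in> DI_space" "g \<in> DI_space"
  shows "(\<lambda>\<theta> x. a * f \<theta> x + b * g \<theta> x) \<in> DI_space"
  using DI_space_two_term[OF assms bij_id bij_id, of "\<lambda>_ _. a" "\<lambda>_ _. b" "max (cmod a) (cmod b)"]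
  by simp

lemma di_coef_linear:
  assumes "f \<in> DI_space" "g \<in> DI_space"
  shows "di_coef (\<lambda>\<theta> x. a * f \<theta> x + b * g \<theta> x) = (\<lambda>x k. a * di_coef f x k + b * di_coef g x k)"
  using DI_space_integrable[OF assms(1)] DI_space_integrable[OF assms(2)]
  by (intro ext) (simp add: di_coef_def fcoef_add fcoef_cmult)

lemma di_unitary_dualize: "di_unitary (dualize \<Phi>)"
  unfolding di_unitary_def
proof (intro conjI ballI allI impI)
  fix f g assume fg: "f \<in> DI_space" "g \<in> DI_space"
  note D = dualize_in_DI_space di_coef_dualize
  show "di_eq (dualize \<Phi> f) (dualize \<Phi> g)" if "di_eq f g"
    using that fg by (simp add: di_eq_iff_di_coef D)
  show "di_eq (dualize \<Phi> (\<lambda>\<theta> x. a * f \<theta> x + b * g \<theta> x))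
      (\<lambda>\<theta> x. a * dualize \<Phi> f \<theta> x + b * dualize \<Phi> g \<theta> x)" for a b
    using fg by (simp add: di_eq_iff_di_coef D DI_space_linear di_coef_linear dual_linear)
next
  fix f assume f: "f \<in> DI_space"
  then show "dualize \<Phi> f \<in> DI_space" by (rule dualize_in_DI_space)
  show "di_norm2 (dualize \<Phi> f) = di_norm2 f"
    using f by (simp add: di_norm2_eq_l2_nn dualize_in_DI_space di_coef_dualize l2_nn_dual)
next
  fix g assume g: "g \<in> DI_space"
  \<comment> \<open>The norm of the preimage needs no computation: the isometry of
    \<open>dual\<close> is applied to it.\<close>
  have "l2_nn (dual_inv \<Phi> (di_coef g)) = l2_nn (di_coef g)"
    using l2_nn_dual[of \<Phi> "dual_inv \<Phi> (di_coef g)"] by (simp add: dual_dual_inv)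
  then obtain f where f: "f \<in> DI_space" "di_coef f = dual_inv \<Phi> (di_coef g)"
    using ex_di_coef l2_nn_di_coef_finite[OF g] by metis
  then have "di_eq (dualize \<Phi> f) g"
    using g by (simp add: di_eq_iff_di_coef dualize_in_DI_space di_coef_dualize dual_dual_inv)
  with f show "\<exists>f\<in>DI_space. di_eq (dualize \<Phi> f) g" by blast
qed

section \<open>Duality of shift and coin\<close>

definition row_finite :: "opmat \<Rightarrow> bool" where
  "row_finite A \<longleftrightarrow> (\<forall>x. finite {y. A x y \<noteq> 0})"

lemma infsum_eq_sum:
  fixes h :: "'a \<Rightarrow> complex"
  assumes "finite F" "\<And>y. y \<notin> F \<Longrightarrow> h y = 0"
  shows "(\<Sum>\<^sub>\<infinity>y. h y) = (\<Sum>y\<in>F. h y)"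
proof -
  have "(\<Sum>\<^sub>\<infinity>y. h y) = (\<Sum>\<^sub>\<infinity>y\<in>F. h y)"
    using assms by (intro infsum_cong_neutral) auto
  then show ?thesis using assms by simp
qed

lemma mat_apply_eq_sum:
  assumes "finite F" "\<And>y. y \<notin> F \<Longrightarrow> A x y = 0"
  shows "mat_apply A \<psi> x = (\<Sum>y\<in>F. A x y * \<psi> y)"
  unfolding mat_apply_def using assms by (intro infsum_eq_sum) auto

text \<open>With finite rows every sum is finite and may be exchanged, so the rule holds for every
  \<psi>. In the direct integral it can therefore be used at every \<theta>, including those where
  the fibre vector is not square summable.\<close>

lemma mat_apply_mat_mult:
  assumes A: "row_finite A" and B: "row_finite B"
  shows "mat_apply (mat_mult A B) \<psi> = mat_apply A (mat_apply B \<psi>)"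
proof
  fix x
  define R where "R = {z. A x z \<noteq> 0}"
  define T where "T = (\<Union>z\<in>R. {y. B z y \<noteq> 0})"
  have R: "finite R" 
    unfolding R_def using A[unfolded row_finite_def] ..
  then have T: "finite T" 
    unfolding T_def using B[unfolded row_finite_def, rule_format] by (rule finite_UN_I)
  have AB: "mat_mult A B x y = (\<Sum>z\<in>R. A x z * B z y)" for y
    unfolding mat_mult_def using R by (intro infsum_eq_sum) (auto simp: R_def)
  have "mat_apply (mat_mult A B) \<psi> x = (\<Sum>y\<in>T. mat_mult A B x y * \<psi> y)"
    by (rule mat_apply_eq_sum[OF T]) (auto simp: AB T_def intro!: sum.neutral)
  also have "\<dots> = (\<Sum>z\<in>R. \<Sum>y\<in>T. A x z * (B z y * \<psi> y))"
    unfolding AB by (subst sum.swap) (simp add: sum_distrib_right mult.assoc)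
  also have "\<dots> = (\<Sum>z\<in>R. A x z * mat_apply B \<psi> z)"
  proof (rule sum.cong[OF refl])
    fix z assume "z \<in> R"
    then have "mat_apply B \<psi> z = (\<Sum>y\<in>T. B z y * \<psi> y)"
      by (intro mat_apply_eq_sum[OF T]) (auto simp: T_def)
    then show "(\<Sum>y\<in>T. A x z * (B z y * \<psi> y)) = A x z * mat_apply B \<psi> z"
      by (simp add: sum_distrib_left)
  qed
  also have "\<dots> = mat_apply A (mat_apply B \<psi>) x"
    by (rule mat_apply_eq_sum[OF R, symmetric]) (auto simp: R_def)
  finally show "mat_apply (mat_mult A B) \<psi> x = mat_apply A (mat_apply B \<psi>) x" .
qed

lemma mat_transpose_mat_mult:
  "mat_transpose (mat_mult A B) = mat_mult (mat_transpose B) (mat_transpose A)"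
  by (simp add: mat_transpose_def mat_mult_def mult.commute)

lemma row_finiteI:
  assumes "\<And>x. finite (F x)" "\<And>x y. y \<notin> F x \<Longrightarrow> A x y = 0"
  shows "row_finite A"
  unfolding row_finite_def
proof
  fix x
  have "{y. A x y \<noteq> 0} \<subseteq> F x" using assms(2) by blast
  then show "finite {y. A x y \<noteq> 0}" using assms(1) finite_subset by blast
qed

lemma row_finite_S_ent: "row_finite (S_ent l)"
  by (rule row_finiteI[where F = "\<lambda>(n, s). {(if s then n - 1 else n + 1, s), (n, \<not> s)}"])
     (auto simp: S_ent_def split: if_splits)

lemma row_finite_S_ent_transpose: "row_finite (mat_transpose (S_ent l))"
  by (rule row_finiteI[where F = "\<lambda>(n, s). {(if s then n + 1 else n - 1, s), (n, \<not> s)}"])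
     (auto simp: S_ent_def mat_transpose_def split: if_splits)

lemma row_finite_Q_ent: "row_finite (Q_ent l \<Phi> \<theta>)"
  by (rule row_finiteI[where F = "\<lambda>(n, s). {(n, s), (n, \<not> s)}"]) (auto simp: Q_ent_def)

lemma row_finite_Q_ent_transpose: "row_finite (mat_transpose (Q_ent l \<Phi> \<theta>))"
  by (rule row_finiteI[where F = "\<lambda>(n, s). {(n, s), (n, \<not> s)}"]) (auto simp: Q_ent_def mat_transpose_def)

lemma mat_apply_S_ent:
  "mat_apply (S_ent l) \<psi> = (\<lambda>(n, s). of_real l * \<psi> (if s then n - 1 else n + 1, s)
    + (if s then - of_real (lam' l) else of_real (lam' l)) * \<psi> (n, \<not> s))"
proof
  fix x :: idx
  obtain n s where x: "x = (n, s)" by force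
  have "mat_apply (S_ent l) \<psi> x =
      (\<Sum>y\<in>{(if s then n - 1 else n + 1, s), (n, \<not> s)}. S_ent l x y * \<psi> y)"
    by (rule mat_apply_eq_sum) (auto simp: S_ent_def x split: if_splits)
  then show "mat_apply (S_ent l) \<psi> x = (case x of (n, s) \<Rightarrow>
      of_real l * \<psi> (if s then n - 1 else n + 1, s)
      + (if s then - of_real (lam' l) else of_real (lam' l)) * \<psi> (n, \<not> s))"
    by (cases s) (auto simp: x S_ent_def)
qed

lemma mat_apply_S_ent_transpose:
  "mat_apply (mat_transpose (S_ent l)) \<psi> = (\<lambda>(n, s). of_real l * \<psi> (if s then n + 1 else n - 1, s)
    + (if s then of_real (lam' l) else - of_real (lam' l)) * \<psi> (n, \<not> s))"
proof
  fix x :: idx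
  obtain n s where x: "x = (n, s)" by force
  have "mat_apply (mat_transpose (S_ent l)) \<psi> x =
      (\<Sum>y\<in>{(if s then n + 1 else n - 1, s), (n, \<not> s)}. mat_transpose (S_ent l) x y * \<psi> y)"
    by (rule mat_apply_eq_sum) (auto simp: S_ent_def mat_transpose_def x split: if_splits)
  then show "mat_apply (mat_transpose (S_ent l)) \<psi> x = (case x of (n, s) \<Rightarrow>
      of_real l * \<psi> (if s then n + 1 else n - 1, s)
      + (if s then of_real (lam' l) else - of_real (lam' l)) * \<psi> (n, \<not> s))"
    by (cases s) (auto simp: x S_ent_def mat_transpose_def)
qed

lemma mat_apply_Q_ent:
  "mat_apply (Q_ent l \<Phi> \<theta>) \<psi> =
    (\<lambda>(n, s). Q_blk l \<Phi> \<theta> n s s * \<psi> (n, s) + Q_blk l \<Phi> \<theta> n s (\<not> s) * \<psi> (n, \<not> s))"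
proof
  fix x :: idx
  obtain n s where x: "x = (n, s)" by force
  have "mat_apply (Q_ent l \<Phi> \<theta>) \<psi> x = (\<Sum>y\<in>{(n, s), (n, \<not> s)}. Q_ent l \<Phi> \<theta> x y * \<psi> y)"
    by (rule mat_apply_eq_sum) (auto simp: Q_ent_def x)
  then show "mat_apply (Q_ent l \<Phi> \<theta>) \<psi> x = (case x of (n, s) \<Rightarrow>
      Q_blk l \<Phi> \<theta> n s s * \<psi> (n, s) + Q_blk l \<Phi> \<theta> n s (\<not> s) * \<psi> (n, \<not> s))"
    by (simp add: x Q_ent_def)
qed

lemma mat_apply_Q_ent_transpose:
  "mat_apply (mat_transpose (Q_ent l \<Phi> \<theta>)) \<psi> =
    (\<lambda>(n, s). Q_blk l \<Phi> \<theta> n s s * \<psi> (n, s) + Q_blk l \<Phi> \<theta> n (\<not> s) s * \<psi> (n, \<not> s))"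
proof
  fix x :: idx
  obtain n s where x: "x = (n, s)" by force
  have "mat_apply (mat_transpose (Q_ent l \<Phi> \<theta>)) \<psi> x =
      (\<Sum>y\<in>{(n, s), (n, \<not> s)}. mat_transpose (Q_ent l \<Phi> \<theta>) x y * \<psi> y)"
    by (rule mat_apply_eq_sum) (auto simp: Q_ent_def mat_transpose_def x)
  then show "mat_apply (mat_transpose (Q_ent l \<Phi> \<theta>)) \<psi> x = (case x of (n, s) \<Rightarrow>
      Q_blk l \<Phi> \<theta> n s s * \<psi> (n, s) + Q_blk l \<Phi> \<theta> n (\<not> s) s * \<psi> (n, \<not> s))"
    by (simp add: x Q_ent_def mat_transpose_def)
qed

section \<open>Action of shift and coin on Fourier coefficients, and the intertwining
  relations\<close>

lemma bij_spin_flip: "bij (\<lambda>x :: idx. (fst x, \<not> snd x))"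
  by (rule bij_betw_byWitness[where f' = "\<lambda>x. (fst x, \<not> snd x)"]) auto

text \<open>The two spins move in opposite directions; \<open>a = - 1\<close> serves
  \<open>S\<close> and \<open>a = 1\<close> its transpose.\<close>

lemma bij_spin_shift: "bij (\<lambda>x :: idx. (if snd x then fst x + a else fst x - a, snd x))"
  by (rule bij_betw_byWitness[where f' = "\<lambda>x. (if snd x then fst x - a else fst x + a, snd x)"])
     (auto split: if_splits)

lemma norm_Q_blk_le: "cmod (Q_blk l \<Phi> \<theta> n s t) \<le> \<bar>l\<bar> + \<bar>lam' l\<bar>"
proof -
  have *: "\<bar>l * cos a\<bar> \<le> \<bar>l\<bar>" "\<bar>l * sin a\<bar> \<le> \<bar>l\<bar>" for a
    by (simp_all add: abs_mult mult_left_le)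
  have "cmod (complex_of_real (l * cos a) + \<i> * complex_of_real (lam' l)) \<le> \<bar>l\<bar> + \<bar>lam' l\<bar>"
    "cmod (complex_of_real (l * cos a) - \<i> * complex_of_real (lam' l)) \<le> \<bar>l\<bar> + \<bar>lam' l\<bar>" for a
    using *(1)[of a]
    by (auto intro!: order_trans[OF norm_triangle_ineq] order_trans[OF norm_triangle_ineq4]
        simp: norm_mult simp del: of_real_mult)
  moreover have "cmod (- complex_of_real (l * sin a)) \<le> \<bar>l\<bar> + \<bar>lam' l\<bar>"
    "cmod (complex_of_real (l * sin a)) \<le> \<bar>l\<bar> + \<bar>lam' l\<bar>" for a
    using *(2)[of a] by (simp_all only: norm_minus_cancel norm_of_real)
  ultimately show ?thesis
    by (simp only: Q_blk_def Let_def split: if_split) blast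
qed

lemma Q_blk_measurable [measurable]: "(\<lambda>\<theta>. Q_blk l \<Phi> \<theta> n s t) \<in> borel_measurable Tmeas"
proof (rule borel_measurable_Tmeas)
  have "continuous_on UNIV (\<lambda>\<theta>. Q_blk l \<Phi> \<theta> n s t)"
    unfolding Q_blk_def Let_def by (cases s; cases t) (auto intro!: continuous_intros)
  then show "(\<lambda>\<theta>. Q_blk l \<Phi> \<theta> n s t) \<in> borel_measurable borel"
    by (rule borel_measurable_continuous_onI)
qed

text \<open>An entry of \<open>Q\<close> seen on coefficients: each of the two exponentials in the
  cosine and sine moves the frequency by one and carries a phase depending on
  \<open>n\<close>.\<close>

definition Q_coef :: "real \<Rightarrow> real \<Rightarrow> int \<Rightarrow> bool \<Rightarrow> bool \<Rightarrow> (int \<Rightarrow> complex) \<Rightarrow> int \<Rightarrow> complex" where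
  "Q_coef l \<Phi> n s t h k =
    (if s = t then of_real l / 2 * (qphase \<Phi> n * h (k - 1) + qphase \<Phi> (- n) * h (k + 1))
        + (if s then \<i> else - \<i>) * of_real (lam' l) * h k
     else (if s then \<i> else - \<i>) * of_real l / 2 * (qphase \<Phi> n * h (k - 1) - qphase \<Phi> (- n) * h (k + 1)))"

text \<open>Euler's formulas, arranged as \<open>a * trig 1 + b * trig (- 1) + c\<close> for
  \<open>fcoef_trig_combination\<close>; this is the reason for the \<open>+ 0\<close> and for the
  minus sign inside the second coefficient.\<close>

lemma Q_blk_eq_trig:
  "Q_blk l \<Phi> \<theta> n s t =
    (if s = t then of_real l / 2 * qphase \<Phi> n * trig 1 \<theta> + of_real l / 2 * qphase \<Phi> (- n) * trig (- 1) \<theta>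
        + (if s then \<i> else - \<i>) * of_real (lam' l)
     else (if s then \<i> else - \<i>) * of_real l / 2 * qphase \<Phi> n * trig 1 \<theta>
        + - ((if s then \<i> else - \<i>) * of_real l / 2 * qphase \<Phi> (- n)) * trig (- 1) \<theta> + 0)"
proof -
  define a where "a = 2 * pi * (of_int n * \<Phi> + \<theta>)"
  have 1: "qphase \<Phi> n * trig 1 \<theta> = cis a"
    by (simp add: qphase_def trig_def cis_mult a_def algebra_simps)
  have 2: "qphase \<Phi> (- n) * trig (- 1) \<theta> = cis (- a)"
    by (simp add: qphase_def trig_def cis_mult a_def algebra_simps)
  show ?thesis
    unfolding mult.assoc[of _ "qphase \<Phi> n"] mult.assoc[of _ "qphase \<Phi> (- n)"] mult_minus_left 1 2
    by (simp add: Q_blk_def a_def[symmetric] complex_eq_iff)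
qed

lemma fcoef_trig_combination:
  assumes "integrable Tmeas h"
  shows "fcoef (\<lambda>\<theta>. (a * trig 1 \<theta> + b * trig (- 1) \<theta> + c) * h \<theta>) k =
    a * fcoef h (k - 1) + b * fcoef h (k + 1) + c * fcoef h k"
proof -
  have "(a * trig 1 \<theta> + b * trig (- 1) \<theta> + c) * h \<theta> =
      a * (h \<theta> * trig 1 \<theta>) + b * (h \<theta> * trig (- 1) \<theta>) + c * h \<theta>" for \<theta>
    by (simp add: algebra_simps)
  then show ?thesis
    using assms by (simp add: fcoef_add fcoef_cmult fcoef_mult_trig integrable_mult_trig)
qed

lemma fcoef_Q_blk:
  assumes "integrable Tmeas h"
  shows "fcoef (\<lambda>\<theta>. Q_blk l \<Phi> \<theta> n s t * h \<theta>) k = Q_coef l \<Phi> n s t (fcoef h) k"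
  unfolding Q_blk_eq_trig
  by (cases "s = t"; cases s)
     (simp_all only: if_True if_False fcoef_trig_combination[OF assms] Q_coef_def simp_thms,
      simp_all add: algebra_simps)

lemma fcoef_two_term:
  assumes "f \<in> DI_space"
    and "g1 \<in> borel_measurable Tmeas" "g2 \<in> borel_measurable Tmeas"
    and "\<And>\<theta>. cmod (g1 \<theta>) \<le> B" "\<And>\<theta>. cmod (g2 \<theta>) \<le> B"
  shows "fcoef (\<lambda>\<theta>. g1 \<theta> * f \<theta> x + g2 \<theta> * f \<theta> y) k =
    fcoef (\<lambda>\<theta>. g1 \<theta> * f \<theta> x) k + fcoef (\<lambda>\<theta>. g2 \<theta> * f \<theta> y) k"
proof (rule fcoef_add)
  show "integrable Tmeas (\<lambda>\<theta>. g1 \<theta> * f \<theta> x)" "integrable Tmeas (\<lambda>\<theta>. g2 \<theta> * f \<theta> y)"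
    unfolding mult.commute[of "g1 _"] mult.commute[of "g2 _"]
    by (rule integrable_mult_bounded[OF DI_space_integrable[OF assms(1)]], rule assms, rule assms)+
qed

lemma
  assumes f: "f \<in> DI_space"
  shows dint_S_in_DI_space: "dint (\<lambda>_. S_ent l) f \<in> DI_space"
    and di_coef_dint_S: "di_coef (dint (\<lambda>_. S_ent l) f) =
      (\<lambda>(n, s) k. of_real l * di_coef f (if s then n - 1 else n + 1, s) k
        + (if s then - of_real (lam' l) else of_real (lam' l)) * di_coef f (n, \<not> s) k)"
proof -
  \<comment> \<open>The shift is written with \<open>- 1\<close> on both sides to match
    \<open>bij_spin_shift\<close>.\<close>
  have e: "dint (\<lambda>_. S_ent l) f =
    (\<lambda>\<theta> x. of_real l * f \<theta> (if snd x then fst x + (- 1) else fst x - (- 1), snd x)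
      + (if snd x then - of_real (lam' l) else of_real (lam' l)) * f \<theta> (fst x, \<not> snd x))"
    by (simp add: dint_def mat_apply_S_ent fun_eq_iff)
  show "dint (\<lambda>_. S_ent l) f \<in> DI_space"
    unfolding e by (rule DI_space_two_term[OF f f bij_spin_shift bij_spin_flip, where B = "max \<bar>l\<bar> \<bar>lam' l\<bar>"]) auto
  show "di_coef (dint (\<lambda>_. S_ent l) f) =
      (\<lambda>(n, s) k. of_real l * di_coef f (if s then n - 1 else n + 1, s) k
        + (if s then - of_real (lam' l) else of_real (lam' l)) * di_coef f (n, \<not> s) k)"
    unfolding e di_coef_def
    by (intro ext) (simp only: fcoef_add fcoef_cmult DI_space_integrable[OF f] integrable_mult_right
        split_beta; simp)
qed


lemma
  assumes f: "f \<in> DI_space"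
  shows dint_S_transpose_in_DI_space: "dint (\<lambda>_. mat_transpose (S_ent l)) f \<in> DI_space"
    and di_coef_dint_S_transpose: "di_coef (dint (\<lambda>_. mat_transpose (S_ent l)) f) =
      (\<lambda>(n, s) k. of_real l * di_coef f (if s then n + 1 else n - 1, s) k
        + (if s then of_real (lam' l) else - of_real (lam' l)) * di_coef f (n, \<not> s) k)"
proof -
  have e: "dint (\<lambda>_. mat_transpose (S_ent l)) f =
    (\<lambda>\<theta> x. of_real l * f \<theta> (if snd x then fst x + 1 else fst x - 1, snd x)
      + (if snd x then of_real (lam' l) else - of_real (lam' l)) * f \<theta> (fst x, \<not> snd x))"
    by (simp add: dint_def mat_apply_S_ent_transpose fun_eq_iff)
  show "dint (\<lambda>_. mat_transpose (S_ent l)) f \<in> DI_space"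
    unfolding e by (rule DI_space_two_term[OF f f bij_spin_shift bij_spin_flip, where B = "max \<bar>l\<bar> \<bar>lam' l\<bar>"]) auto
  show "di_coef (dint (\<lambda>_. mat_transpose (S_ent l)) f) =
      (\<lambda>(n, s) k. of_real l * di_coef f (if s then n + 1 else n - 1, s) k
        + (if s then of_real (lam' l) else - of_real (lam' l)) * di_coef f (n, \<not> s) k)"
    unfolding e di_coef_def
    by (intro ext) (simp only: fcoef_add fcoef_cmult DI_space_integrable[OF f] integrable_mult_right
        split_beta; simp)
qed

lemma
  assumes f: "f \<in> DI_space"
  shows dint_Q_in_DI_space: "dint (\<lambda>\<theta>. Q_ent l \<Phi> \<theta>) f \<in> DI_space"
    and di_coef_dint_Q: "di_coef (dint (\<lambda>\<theta>. Q_ent l \<Phi> \<theta>) f) =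
      (\<lambda>(n, s) k. Q_coef l \<Phi> n s s (di_coef f (n, s)) k
        + Q_coef l \<Phi> n s (\<not> s) (di_coef f (n, \<not> s)) k)"
proof -
  \<comment> \<open>The inserted \<open>id\<close> plays the part of the first bijection in
    \<open>DI_space_two_term\<close>.\<close>
  have e: "dint (\<lambda>\<theta>. Q_ent l \<Phi> \<theta>) f =
    (\<lambda>\<theta> x. Q_blk l \<Phi> \<theta> (fst x) (snd x) (snd x) * f \<theta> (id x)
      + Q_blk l \<Phi> \<theta> (fst x) (snd x) (\<not> snd x) * f \<theta> (fst x, \<not> snd x))"
    by (simp add: dint_def mat_apply_Q_ent fun_eq_iff)
  show "dint (\<lambda>\<theta>. Q_ent l \<Phi> \<theta>) f \<in> DI_space"
    unfolding e by (rule DI_space_two_term[OF f f bij_id bij_spin_flip _ _ norm_Q_blk_le norm_Q_blk_le]) measurable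
  show "di_coef (dint (\<lambda>\<theta>. Q_ent l \<Phi> \<theta>) f) =
      (\<lambda>(n, s) k. Q_coef l \<Phi> n s s (di_coef f (n, s)) k
        + Q_coef l \<Phi> n s (\<not> s) (di_coef f (n, \<not> s)) k)"
    unfolding e di_coef_def
    by (intro ext) (simp add: fcoef_two_term[OF f Q_blk_measurable Q_blk_measurable norm_Q_blk_le norm_Q_blk_le]
        fcoef_Q_blk DI_space_integrable[OF f] split_beta)
qed

lemma
  assumes f: "f \<in> DI_space"
  shows dint_Q_transpose_in_DI_space: "dint (\<lambda>\<theta>. mat_transpose (Q_ent l \<Phi> \<theta>)) f \<in> DI_space"
    and di_coef_dint_Q_transpose: "di_coef (dint (\<lambda>\<theta>. mat_transpose (Q_ent l \<Phi> \<theta>)) f) =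
      (\<lambda>(n, s) k. Q_coef l \<Phi> n s s (di_coef f (n, s)) k
        + Q_coef l \<Phi> n (\<not> s) s (di_coef f (n, \<not> s)) k)"
proof -
  have e: "dint (\<lambda>\<theta>. mat_transpose (Q_ent l \<Phi> \<theta>)) f =
    (\<lambda>\<theta> x. Q_blk l \<Phi> \<theta> (fst x) (snd x) (snd x) * f \<theta> (id x)
      + Q_blk l \<Phi> \<theta> (fst x) (\<not> snd x) (snd x) * f \<theta> (fst x, \<not> snd x))"
    by (simp add: dint_def mat_apply_Q_ent_transpose fun_eq_iff)
  show "dint (\<lambda>\<theta>. mat_transpose (Q_ent l \<Phi> \<theta>)) f \<in> DI_space"
    unfolding e by (rule DI_space_two_term[OF f f bij_id bij_spin_flip _ _ norm_Q_blk_le norm_Q_blk_le]) measurable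
  show "di_coef (dint (\<lambda>\<theta>. mat_transpose (Q_ent l \<Phi> \<theta>)) f) =
      (\<lambda>(n, s) k. Q_coef l \<Phi> n s s (di_coef f (n, s)) k
        + Q_coef l \<Phi> n (\<not> s) s (di_coef f (n, \<not> s)) k)"
    unfolding e di_coef_def
    by (intro ext) (simp add: fcoef_two_term[OF f Q_blk_measurable Q_blk_measurable norm_Q_blk_le norm_Q_blk_le]
        fcoef_Q_blk DI_space_integrable[OF f] split_beta)
qed

text \<open>Let \<open>T\<close> and \<open>V\<close> be the shift and the multiplication by the
  exponential. Then \<open>S\<close> is \<open>l * ((T + T\<^sup>-\<^sup>1) / 2 + \<sigma>\<^sub>z *
  (T - T\<^sup>-\<^sup>1) / 2) - \<i> * lam' l * \<sigma>\<^sub>y\<close>. The duality replaces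
  \<open>T\<close> by \<open>V\<close>, \<open>\<sigma>\<^sub>z\<close> by
  \<open>\<sigma>\<^sub>y\<close> and \<open>\<sigma>\<^sub>y\<close> by
  \<open>- \<sigma>\<^sub>z\<close>, so that the shifts become cosine and sine; the result is the
  transpose of \<open>Q\<close>.\<close>

lemma dual_S:
  "dual \<Phi> (\<lambda>(n, s) k. of_real l * c (if s then n - 1 else n + 1, s) k
      + (if s then - of_real (lam' l) else of_real (lam' l)) * c (n, \<not> s) k) =
   (\<lambda>(n, s) k. Q_coef l \<Phi> n s s (dual \<Phi> c (n, s)) k
      + Q_coef l \<Phi> n (\<not> s) s (dual \<Phi> c (n, \<not> s)) k)"
proof (intro ext)
  fix x :: idx and k
  obtain n s where x: "x = (n, s)" by force
  \<comment> \<open>The common factor is kept opaque, so that the simplifier does not rearrange the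
    square root.\<close>
  define w where "w = 1 / complex_of_real (sqrt 2)"
  have q: "qphase \<Phi> (n * (k - 1)) = qphase \<Phi> (n * k) * qphase \<Phi> (- n)"
    "qphase \<Phi> (n * (k + 1)) = qphase \<Phi> (n * k) * qphase \<Phi> n"
    by (simp_all add: algebra_simps flip: qphase_add)
  \<comment> \<open>A frequency shift changes the phase by a factor that the phase in
    \<open>Q_coef\<close> cancels.\<close>
  have q': "qphase \<Phi> n * (qphase \<Phi> (n * k) * qphase \<Phi> (- n) * z * w) = qphase \<Phi> (n * k) * z * w"
    "qphase \<Phi> (- n) * (qphase \<Phi> (n * k) * qphase \<Phi> n * z * w) = qphase \<Phi> (n * k) * z * w" for z
    using qphase_minus_cancel[of \<Phi> n] by algebra+
  have d: "dual \<Phi> c (n, s) k = qphase \<Phi> (n * k) * (c (k, s) (- n) + \<i> * c (k, \<not> s) (- n)) * w" for c n s k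
    by (simp add: dual_def w_def)
  show "dual \<Phi> (\<lambda>(n, s) k. of_real l * c (if s then n - 1 else n + 1, s) k
      + (if s then - of_real (lam' l) else of_real (lam' l)) * c (n, \<not> s) k) x k =
    (case x of (n, s) \<Rightarrow> \<lambda>k. Q_coef l \<Phi> n s s (dual \<Phi> c (n, s)) k
      + Q_coef l \<Phi> n (\<not> s) s (dual \<Phi> c (n, \<not> s)) k) k"
    unfolding x prod.case Q_coef_def d q q'
    by (cases s) (simp_all add: field_simps)
qed

text \<open>The same spin substitution, now with \<open>V\<close> replaced by
  \<open>T\<^sup>-\<^sup>1\<close>: the cosine becomes half the sum of the two shifts, and the sine
  term becomes \<open>\<sigma>\<^sub>z * (T\<^sup>-\<^sup>1 - T) / 2\<close>. Spin + thus moves by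
  \<open>T\<^sup>-\<^sup>1\<close> and spin - by \<open>T\<close>, as in the transpose of
  \<open>S\<close>.\<close>

lemma dual_Q:
  "dual \<Phi> (\<lambda>(n, s) k. Q_coef l \<Phi> n s s (c (n, s)) k + Q_coef l \<Phi> n s (\<not> s) (c (n, \<not> s)) k) =
   (\<lambda>(n, s) k. of_real l * dual \<Phi> c (if s then n + 1 else n - 1, s) k
      + (if s then of_real (lam' l) else - of_real (lam' l)) * dual \<Phi> c (n, \<not> s) k)"
proof (intro ext)
  fix x :: idx and k
  obtain n s where x: "x = (n, s)" by force
  define w where "w = 1 / complex_of_real (sqrt 2)"
  have q: "qphase \<Phi> ((n + 1) * k) = qphase \<Phi> (n * k) * qphase \<Phi> k"
    "qphase \<Phi> ((n - 1) * k) = qphase \<Phi> (n * k) * qphase \<Phi> (- k)"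
    by (simp_all add: algebra_simps flip: qphase_add)
  have i: "- (n + 1) = - n - 1" "- (n - 1) = - n + 1" by simp_all
  have d: "dual \<Phi> c (n, s) k = qphase \<Phi> (n * k) * (c (k, s) (- n) + \<i> * c (k, \<not> s) (- n)) * w" for c n s k
    by (simp add: dual_def w_def)
  show "dual \<Phi> (\<lambda>(n, s) k. Q_coef l \<Phi> n s s (c (n, s)) k + Q_coef l \<Phi> n s (\<not> s) (c (n, \<not> s)) k) x k =
    (case x of (n, s) \<Rightarrow> \<lambda>k. of_real l * dual \<Phi> c (if s then n + 1 else n - 1, s) k
      + (if s then of_real (lam' l) else - of_real (lam' l)) * dual \<Phi> c (n, \<not> s) k) k"
    unfolding x prod.case Q_coef_def d
    by (cases s) (simp_all only: if_True if_False q i simp_thms, simp_all add: field_simps)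
qed

theorem theorem2p3:
  fixes l1 l2 \<Phi> :: real
  assumes "0 \<le> l1" "l1 \<le> 1" "0 \<le> l2" "l2 \<le> 1"
  shows "di_unitarily_equivalent (\<lambda>\<theta>. W_ent l1 l2 \<Phi> \<theta>) (\<lambda>\<theta>. W_sharp_ent l1 l2 \<Phi> \<theta>)"
  unfolding di_unitarily_equivalent_def
proof (intro exI[of _ "dualize \<Phi>"] conjI ballI di_unitary_dualize)
  fix f assume f: "f \<in> DI_space"
  let ?Q = "dint (\<lambda>\<theta>. Q_ent l2 \<Phi> \<theta>)" and ?S = "dint (\<lambda>_. S_ent l1)"
  \<comment> \<open>The couplings trade places: \<open>l1\<close> sits in the shift of
    \<open>W\<close> and in the coin of the dual operator. Reversing the factors under the transpose
    gives the order \<open>?Q'\<close> after \<open>?S'\<close>, which matches the images of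
    \<open>?S\<close> and \<open>?Q\<close>.\<close>
  let ?Q' = "dint (\<lambda>\<theta>. mat_transpose (Q_ent l1 \<Phi> \<theta>))" and ?S' = "dint (\<lambda>_. mat_transpose (S_ent l2))"
  have W: "dint (\<lambda>\<theta>. W_ent l1 l2 \<Phi> \<theta>) g = ?S (?Q g)" for g
    by (simp add: dint_def W_ent_def mat_apply_mat_mult row_finite_S_ent row_finite_Q_ent)
  have W': "dint (\<lambda>\<theta>. W_sharp_ent l1 l2 \<Phi> \<theta>) g = ?Q' (?S' g)" for g
    by (simp add: dint_def W_sharp_ent_def W_ent_def mat_transpose_mat_mult mat_apply_mat_mult
        row_finite_S_ent_transpose row_finite_Q_ent_transpose)
  note DI = dint_S_in_DI_space dint_Q_in_DI_space dint_S_transpose_in_DI_space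
    dint_Q_transpose_in_DI_space dualize_in_DI_space
  have "di_coef (dualize \<Phi> (?S (?Q f))) = di_coef (?Q' (?S' (dualize \<Phi> f)))"
    using f by (simp only: di_coef_dualize di_coef_dint_S di_coef_dint_Q di_coef_dint_S_transpose
        di_coef_dint_Q_transpose DI dual_S dual_Q)
  then show "di_eq (dualize \<Phi> (dint (\<lambda>\<theta>. W_ent l1 l2 \<Phi> \<theta>) f))
      (dint (\<lambda>\<theta>. W_sharp_ent l1 l2 \<Phi> \<theta>) (dualize \<Phi> f))"
    using f by (simp add: W W' di_eq_iff_di_coef DI)
qed

end
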